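(* Every finitely generated projective unital $\ell$-group $(G,u)$ has a basis.
   Context: A lattice-ordered abelian group ($\ell$-group) is a structure $(G,+,-,0,\vee,\wedge)$ such that $(G,+,-,0)$ is an abelian group, $(G,\vee,\wedge)$ is a lattice, and $x+(y\vee z)=(x+y)\vee(x+z)$ for all $x,y,z\in G$. An order-unit is an element $u\in G$ such that for every $g\in G$ there is $n\in\{1,2,\ldots\}$ with $g\le nu$. A unital $\ell$-group $(G,u)$ is an $\ell$-group $G$ with a distinguished order-unit $u$. Morphisms of unital $\ell$-groups are unital $\ell$-homomorphisms, i.e. maps $h\colon(G,u)\to(G',u')$ preserving the group and lattice structure with $h(u)=u'$. An ideal of $(G,u)$ is the kernel of a unital $\ell$-homomorphism of $(G,u)$. $\mathrm{MaxSpec}(G)$ is the set of maximal (proper) ideals of $(G,u)$ with the spectral topology: a basis of closed sets is given by the sets $\{\mathfrak p\in\mathrm{MaxSpec}(G)\mid a\in\mathfrak p\}$, $a\in G$. Projective: $(G,u)$ is projective if whenever $\psi\colon(A,a)\to(B,b)$ is a surjective morphism of unital $\ell$-groups and $\phi\colon(G,u)\to(B,b)$ is a morphism, there is a morphism $\theta\colon(G,u)\to(A,a)$ such that $\phi=\psi\circ\theta$. Basis: a basis of $(G,u)$ is a set $\mathcal B=\{b_1,\ldots,b_n\}$ of nonzero elements of the positive cone $G^+=\{g\in G\mid g\ge 0\}$ such that (i) $\mathcal B$ generates $G$ (as an $\ell$-group); (ii) for each $k=1,2,\ldots$ and each $k$-element subset $C$ of $\mathcal B$ with $\bigwedge\{b\mid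 b\in C\}\neq 0$, the set $\{\mathfrak m\in\mathrm{MaxSpec}(G)\mid \mathfrak m\supseteq\mathcal B\setminus C\}$ is homeomorphic to a $(k-1)$-simplex; (iii) there are integers $m_1,\ldots,m_n\ge 1$ such that $\sum_{i=1}^n m_ib_i=u$. *)

theory Defs
  imports "HOL-Algebra.Algebra" "HOL-Homology.Simplices"
begin

text \<open>
  Following \<^theory>\<open>HOL-Algebra.Group\<close>, the abelian group underlying an $\ell$-group is written
  multiplicatively: \<open>\<otimes>\<close>, \<open>inv\<close>, \<open>\<one>\<close> and \<open>[^]\<close> stand for $+$, $-$, $0$ and integer multiples.
\<close>

record 'a lgroup = "'a monoid" +
  ljoin :: "['a, 'a] \<Rightarrow> 'a" (infixl "\<curlyvee>\<index>" 65)
  lmeet :: "['a, 'a] \<Rightarrow> 'a" (infixl "\<curlywedge>\<index>" 70)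

locale lgroup = comm_group G for G :: "('a, 'm) lgroup_scheme" (structure) +
  assumes join_closed: "\<lbrakk>x \<in> carrier G; y \<in> carrier G\<rbrakk> \<Longrightarrow> x \<curlyvee> y \<in> carrier G"
    and meet_closed: "\<lbrakk>x \<in> carrier G; y \<in> carrier G\<rbrakk> \<Longrightarrow> x \<curlywedge> y \<in> carrier G"
    and join_comm: "\<lbrakk>x \<in> carrier G; y \<in> carrier G\<rbrakk> \<Longrightarrow> x \<curlyvee> y = y \<curlyvee> x"
    and meet_comm: "\<lbrakk>x \<in> carrier G; y \<in> carrier G\<rbrakk> \<Longrightarrow> x \<curlywedge> y = y \<curlywedge> x"
    and join_assoc: "\<lbrakk>x \<in> carrier G; y \<in> carrier G; z \<in> carrier G\<rbrakk>
      \<Longrightarrow> (x \<curlyvee> y) \<curlyvee> z = x \<curlyvee> (y \<curlyvee> z)"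
    and meet_assoc: "\<lbrakk>x \<in> carrier G; y \<in> carrier G; z \<in> carrier G\<rbrakk>
      \<Longrightarrow> (x \<curlywedge> y) \<curlywedge> z = x \<curlywedge> (y \<curlywedge> z)"
    and join_absorb: "\<lbrakk>x \<in> carrier G; y \<in> carrier G\<rbrakk> \<Longrightarrow> x \<curlyvee> (x \<curlywedge> y) = x"
    and meet_absorb: "\<lbrakk>x \<in> carrier G; y \<in> carrier G\<rbrakk> \<Longrightarrow> x \<curlywedge> (x \<curlyvee> y) = x"
    and mult_join_distrib: "\<lbrakk>x \<in> carrier G; y \<in> carrier G; z \<in> carrier G\<rbrakk>
      \<Longrightarrow> x \<otimes> (y \<curlyvee> z) = (x \<otimes> y) \<curlyvee> (x \<otimes> z)"

definition lorder :: "('a, 'm) lgroup_scheme \<Rightarrow> 'a gorder" where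
  "lorder G = \<lparr>carrier = carrier G, eq = (=), le = (\<lambda>x y. x \<curlywedge>\<^bsub>G\<^esub> y = x)\<rparr>"

lemma (in lgroup) lattice_lorder: "lattice (lorder G)"
proof -
  have idem: "x \<curlywedge> x = x" if "x \<in> carrier G" for x
    using join_absorb[OF that that] meet_absorb[OF that meet_closed[OF that that]] by simp
  have trans: "x \<curlywedge> z = x"
    if "x \<curlywedge> y = x" "y \<curlywedge> z = y" "x \<in> carrier G" "y \<in> carrier G" "z \<in> carrier G" for x y z
    using meet_assoc[OF that(3,4,5)] that(1,2) by simp
  have lower: "(x \<curlywedge> y) \<curlywedge> x = x \<curlywedge> y" "(x \<curlywedge> y) \<curlywedge> y = x \<curlywedge> y"
    if x: "x \<in> carrier G" and y: "y \<in> carrier G" for x y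
    using meet_assoc[OF x y y] meet_assoc[OF x x y] meet_comm[OF x meet_closed[OF x y]]
    by (simp_all add: idem x y)
  have upper: "x \<curlywedge> (x \<curlyvee> y) = x" "y \<curlywedge> (x \<curlyvee> y) = y"
    if x: "x \<in> carrier G" and y: "y \<in> carrier G" for x y
    using meet_absorb[OF x y] meet_absorb[OF y x] join_comm[OF x y] by simp_all
  have le_join: "x \<curlyvee> y = y" if "x \<curlywedge> y = x" and x: "x \<in> carrier G" and y: "y \<in> carrier G" for x y
    using join_absorb[OF y x] meet_comm[OF x y] join_comm[OF x y] that(1) by simp
  have lub: "(x \<curlyvee> y) \<curlywedge> z = x \<curlyvee> y"
    if "x \<curlywedge> z = x" "y \<curlywedge> z = y" and c: "x \<in> carrier G" "y \<in> carrier G" "z \<in> carrier G" for x y z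
  proof -
    have "(x \<curlyvee> y) \<curlyvee> z = z"
      using join_assoc[OF c] le_join[OF that(1) c(1,3)] le_join[OF that(2) c(2,3)] by simp
    then show ?thesis
      using meet_absorb[OF join_closed[OF c(1,2)] c(3)] by simp
  qed
  have glb: "z \<curlywedge> (x \<curlywedge> y) = z"
    if "z \<curlywedge> x = z" "z \<curlywedge> y = z" "x \<in> carrier G" "y \<in> carrier G" "z \<in> carrier G" for x y z
    using meet_assoc[OF that(5,3,4)] that(1,2) by simp
  have antisym: "x = y"
    if "x \<curlywedge> y = x" "y \<curlywedge> x = y" "x \<in> carrier G" "y \<in> carrier G" for x y
    using meet_comm[OF that(3,4)] that(1,2) by simp
  have po: "partial_order (lorder G)"
  proof
    fix x y z
    assume "x \<sqsubseteq>\<^bsub>lorder G\<^esub> y" "y \<sqsubseteq>\<^bsub>lorder G\<^esub> z"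
      "x \<in> carrier (lorder G)" "y \<in> carrier (lorder G)" "z \<in> carrier (lorder G)"
    then show "x \<sqsubseteq>\<^bsub>lorder G\<^esub> z" by (simp add: lorder_def trans[of x y z])
  next
    fix x y
    assume "x \<sqsubseteq>\<^bsub>lorder G\<^esub> y" "y \<sqsubseteq>\<^bsub>lorder G\<^esub> x"
      "x \<in> carrier (lorder G)" "y \<in> carrier (lorder G)"
    then show "x .=\<^bsub>lorder G\<^esub> y" using antisym[of x y] by (simp add: lorder_def)
  qed (simp_all add: lorder_def idem)
  interpret partial_order "lorder G" by (rule po)
  show ?thesis
  proof
    fix x y assume "x \<in> carrier (lorder G)" "y \<in> carrier (lorder G)"
    then have xy: "x \<in> carrier G" "y \<in> carrier G" by (simp_all add: lorder_def)
    have "least (lorder G) (x \<curlyvee> y) (Upper (lorder G) {x, y})"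
      by (simp add: least_def Upper_def lorder_def xy join_closed upper lub subset_iff)
    then show "\<exists>s. least (lorder G) s (Upper (lorder G) {x, y})" ..
    have "greatest (lorder G) (x \<curlywedge> y) (Lower (lorder G) {x, y})"
      by (simp add: greatest_def Lower_def lorder_def xy meet_closed lower glb subset_iff)
    then show "\<exists>s. greatest (lorder G) s (Lower (lorder G) {x, y})" ..
  qed
qed

locale unital_lgroup = lgroup G for G :: "('a, 'm) lgroup_scheme" (structure) and u +
  assumes unit_closed: "u \<in> carrier G"
    and order_unit: "g \<in> carrier G \<Longrightarrow> \<exists>n::nat. n \<ge> 1 \<and> g \<sqsubseteq>\<^bsub>lorder G\<^esub> u [^] n"

definition ulhom ::
  "('a, 'm) lgroup_scheme \<Rightarrow> 'a \<Rightarrow> ('b, 'n) lgroup_scheme \<Rightarrow> 'b \<Rightarrow> ('a \<Rightarrow> 'b) set" where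
  "ulhom G u H v = {h \<in> hom G H.
     (\<forall>x\<in>carrier G. \<forall>y\<in>carrier G. h (x \<curlyvee>\<^bsub>G\<^esub> y) = h x \<curlyvee>\<^bsub>H\<^esub> h y) \<and>
     (\<forall>x\<in>carrier G. \<forall>y\<in>carrier G. h (x \<curlywedge>\<^bsub>G\<^esub> y) = h x \<curlywedge>\<^bsub>H\<^esub> h y) \<and>
     h u = v}"

text \<open>
  An ideal is the kernel of a morphism. Codomains over \<open>'a set\<close> suffice, since the image of a
  morphism is isomorphic to the quotient by its kernel, whose elements are cosets.
\<close>

definition lideal :: "('a, 'm) lgroup_scheme \<Rightarrow> 'a \<Rightarrow> 'a set \<Rightarrow> bool" where
  "lideal G u I \<longleftrightarrow> (\<exists>(H :: 'a set lgroup) v h.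
     unital_lgroup H v \<and> h \<in> ulhom G u H v \<and> I = kernel G H h)"

definition MaxSpec :: "('a, 'm) lgroup_scheme \<Rightarrow> 'a \<Rightarrow> 'a set set" where
  "MaxSpec G u = {\<mm>. lideal G u \<mm> \<and> \<mm> \<noteq> carrier G \<and>
     (\<forall>J. lideal G u J \<longrightarrow> \<mm> \<subseteq> J \<longrightarrow> J = \<mm> \<or> J = carrier G)}"

definition spectral_topology :: "('a, 'm) lgroup_scheme \<Rightarrow> 'a \<Rightarrow> 'a set topology" where
  "spectral_topology G u = topology_generated_by
     ((\<lambda>a. MaxSpec G u - {\<mm> \<in> MaxSpec G u. a \<in> \<mm>}) ` carrier G)"

lemma topspace_spectral_topology: "topspace (spectral_topology G u) = MaxSpec G u"
proof -
  have "\<exists>a\<in>carrier G. a \<notin> \<mm>" if "\<mm> \<in> MaxSpec G u" for \<mm>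
    using that by (auto simp: MaxSpec_def lideal_def kernel_def)
  then show ?thesis
    by (auto simp: spectral_topology_def)
qed

inductive_set lgenerate :: "('a, 'm) lgroup_scheme \<Rightarrow> 'a set \<Rightarrow> 'a set" for G and S where
  one: "\<one>\<^bsub>G\<^esub> \<in> lgenerate G S"
| incl: "x \<in> S \<Longrightarrow> x \<in> lgenerate G S"
| inv: "x \<in> lgenerate G S \<Longrightarrow> inv\<^bsub>G\<^esub> x \<in> lgenerate G S"
| mult: "\<lbrakk>x \<in> lgenerate G S; y \<in> lgenerate G S\<rbrakk> \<Longrightarrow> x \<otimes>\<^bsub>G\<^esub> y \<in> lgenerate G S"
| join: "\<lbrakk>x \<in> lgenerate G S; y \<in> lgenerate G S\<rbrakk> \<Longrightarrow> x \<curlyvee>\<^bsub>G\<^esub> y \<in> lgenerate G S"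
| meet: "\<lbrakk>x \<in> lgenerate G S; y \<in> lgenerate G S\<rbrakk> \<Longrightarrow> x \<curlywedge>\<^bsub>G\<^esub> y \<in> lgenerate G S"

definition finitely_generated :: "('a, 'm) lgroup_scheme \<Rightarrow> bool" where
  "finitely_generated G \<longleftrightarrow> (\<exists>S. finite S \<and> S \<subseteq> carrier G \<and> lgenerate G S = carrier G)"

text \<open>
  A hypothesis cannot quantify over types, so projectivity is relative to unital $\ell$-groups with
  carriers in a type \<open>'b\<close>. For finitely generated \<open>(G, u)\<close> every infinite \<open>'b\<close> gives the
  same notion: such a \<open>G\<close> is countable and is a quotient of the countable unital $\ell$-group of
  McNaughton functions on a cube, a projective object; hence lifting the identity of (a copy of)
  \<open>G\<close> along this quotient map already makes \<open>G\<close> a retract of a projective.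
\<close>

definition projective :: "'b itself \<Rightarrow> ('a, 'm) lgroup_scheme \<Rightarrow> 'a \<Rightarrow> bool" where
  "projective (_ :: 'b itself) G u \<longleftrightarrow>
     (\<forall>(A :: 'b lgroup) a (B :: 'b lgroup) b \<psi> \<phi>.
        unital_lgroup A a \<longrightarrow> unital_lgroup B b \<longrightarrow>
        \<psi> \<in> ulhom A a B b \<longrightarrow> \<psi> ` carrier A = carrier B \<longrightarrow> \<phi> \<in> ulhom G u B b \<longrightarrow>
        (\<exists>\<theta> \<in> ulhom G u A a. \<forall>x\<in>carrier G. \<phi> x = \<psi> (\<theta> x)))"

definition is_basis :: "('a, 'm) lgroup_scheme \<Rightarrow> 'a \<Rightarrow> 'a set \<Rightarrow> bool" where
  "is_basis G u \<B> \<longleftrightarrow>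
     finite \<B> \<and>
     (\<forall>b\<in>\<B>. b \<in> carrier G \<and> \<one>\<^bsub>G\<^esub> \<sqsubseteq>\<^bsub>lorder G\<^esub> b \<and> b \<noteq> \<one>\<^bsub>G\<^esub>) \<and>
     lgenerate G \<B> = carrier G \<and>
     (\<forall>k\<ge>1. \<forall>C\<subseteq>\<B>. card C = k \<longrightarrow> \<Sqinter>\<^bsub>lorder G\<^esub> C \<noteq> \<one>\<^bsub>G\<^esub> \<longrightarrow>
        subtopology (spectral_topology G u) {\<mm> \<in> MaxSpec G u. \<B> - C \<subseteq> \<mm>}
          homeomorphic_space
        subtopology (powertop_real UNIV) (standard_simplex (k - 1))) \<and>
     (\<exists>m :: 'a \<Rightarrow> int. (\<forall>b\<in>\<B>. m b \<ge> 1) \<and> (\<Otimes>\<^bsub>G\<^esub>b\<in>\<B>. b [^]\<^bsub>G\<^esub> m b) = u)"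

end

theory Submission
  imports Defs
begin

text \<open>
  Let \<open>G\<close> be generated by positive elements \<open>a 0 = u, a 1, \<dots>, a (n - 1)\<close>. A word in these generators is also a
  function on the orthant $[0,\infty)^n$, piecewise linear with integer coefficients. The proof subdivides
  the orthant into a unimodular fan and computes with the Schauder hats of the fan, which are words
  and therefore have values in \<open>G\<close> as well. Subdividing the edge between two vertices with hats \<open>b\<close> and \<open>b'\<close>
  replaces them by \<open>b - (b \<and> b')\<close> and \<open>b' - (b \<and> b')\<close> and adds the hat \<open>b \<and> b'\<close>. The basic properties of hats
  (they are positive, hats not spanning a cone have infimum \<open>0\<close>, every generator is an integer combination of
  hats) are preserved by this operation in any $\ell$-group (\<open>adapted_star\<close>). Since enough subdivisions
  make a given word linear on each cone (\<open>exists_refinement_lin\<close>), that word becomes an integer combination of hats with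
  coefficients its values at the vertices, in \<open>G\<close> just as on the orthant (\<open>lin_ev\<close>).

  Consequently, if a positive word \<open>f\<close> has value \<open>0\<close> in \<open>G\<close>, then the hats of the vertices outside the
  zero set of \<open>f\<close> vanish in \<open>G\<close>. It follows that a word vanishing on the zero set has value \<open>0\<close> in \<open>G\<close>
  (\<open>ev_eq_one_of_vanishing\<close>), and a word positive there has a multiple above the unit
  (\<open>bounded_by_multiple_of_positive\<close>).

  Projectivity enters once. It makes \<open>G\<close> a retract of the group of piecewise linear functions on a compact
  slice of a cone, and a point fixed by the retraction can be evaluated on \<open>G\<close>. Being
  fixed is the vanishing of a word \<open>f\<close>, so \<open>G\<close> is presented by the single relation \<open>f = 0\<close>, and all points of its
  zero set define real-valued homomorphisms (\<open>projective_imp_presentation\<close>).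

  Now subdivide until \<open>f\<close> is linear on the cones. The basis consists of the hats of the vertices at which \<open>f\<close>
  vanishes. They generate \<open>G\<close> because the generators are combinations of them; the coefficients of
  the unit are the denominators of the vertices; hats with nonzero infimum span a cone; and
  since the maximal ideals correspond to the points of the slice (\<open>MaxSpec_points\<close>), those lying over a cone of
  the fan form a simplex (\<open>face_homeomorphic_simplex\<close>).
\<close>

section \<open>Arithmetic in abelian $\ell$-groups\<close>

context lgroup
begin

definition lle :: "'a \<Rightarrow> 'a \<Rightarrow> bool" (infix "\<preceq>" 50) where
  "x \<preceq> y \<longleftrightarrow> x \<curlywedge> y = x"

lemma lorder_iff: "x \<sqsubseteq>\<^bsub>lorder G\<^esub> y \<longleftrightarrow> x \<preceq> y"
  by (simp add: lorder_def lle_def)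

lemma meet_idem: "x \<in> carrier G \<Longrightarrow> x \<curlywedge> x = x"
  using join_absorb[of x x] meet_absorb[of x "x \<curlywedge> x"] meet_closed by simp

lemma lle_refl [simp]: "x \<in> carrier G \<Longrightarrow> x \<preceq> x"
  by (simp add: lle_def meet_idem)

lemma lle_trans [trans]:
  "\<lbrakk>x \<preceq> y; y \<preceq> z; x \<in> carrier G; y \<in> carrier G; z \<in> carrier G\<rbrakk> \<Longrightarrow> x \<preceq> z"
  unfolding lle_def using meet_assoc[of x y z] by simp

lemma lle_antisym: "\<lbrakk>x \<preceq> y; y \<preceq> x; x \<in> carrier G; y \<in> carrier G\<rbrakk> \<Longrightarrow> x = y"
  unfolding lle_def using meet_comm[of x y] by simp

lemma lle_join_iff: "\<lbrakk>x \<in> carrier G; y \<in> carrier G\<rbrakk> \<Longrightarrow> x \<preceq> y \<longleftrightarrow> x \<curlyvee> y = y"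
  unfolding lle_def using join_absorb[of y x] meet_absorb[of x y] meet_comm[of x y] join_comm[of x y]
  by auto

lemma meet_lle1: "\<lbrakk>x \<in> carrier G; y \<in> carrier G\<rbrakk> \<Longrightarrow> x \<curlywedge> y \<preceq> x"
  unfolding lle_def using meet_assoc[of x x y] meet_comm[of x "x \<curlywedge> y"]
  by (simp add: meet_idem meet_closed)

lemma meet_lle2: "\<lbrakk>x \<in> carrier G; y \<in> carrier G\<rbrakk> \<Longrightarrow> x \<curlywedge> y \<preceq> y"
  using meet_lle1[of y x] by (simp add: meet_comm)

lemma meet_greatest:
  "\<lbrakk>z \<preceq> x; z \<preceq> y; x \<in> carrier G; y \<in> carrier G; z \<in> carrier G\<rbrakk> \<Longrightarrow> z \<preceq> x \<curlywedge> y"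
  unfolding lle_def using meet_assoc[of z x y] by simp

lemma join_lge1: "\<lbrakk>x \<in> carrier G; y \<in> carrier G\<rbrakk> \<Longrightarrow> x \<preceq> x \<curlyvee> y"
  unfolding lle_def by (rule meet_absorb)

lemma join_lge2: "\<lbrakk>x \<in> carrier G; y \<in> carrier G\<rbrakk> \<Longrightarrow> y \<preceq> x \<curlyvee> y"
  using join_lge1[of y x] by (simp add: join_comm)

lemma join_least:
  "\<lbrakk>x \<preceq> z; y \<preceq> z; x \<in> carrier G; y \<in> carrier G; z \<in> carrier G\<rbrakk> \<Longrightarrow> x \<curlyvee> y \<preceq> z"
  using join_assoc[of x y z] by (simp add: lle_join_iff join_closed)

lemma mult_lle_mono:
  assumes "x \<preceq> y" "x \<in> carrier G" "y \<in> carrier G" "z \<in> carrier G"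
  shows "z \<otimes> x \<preceq> z \<otimes> y"
  using assms mult_join_distrib[of z x y] by (simp add: lle_join_iff)

lemma mult_lle_mono2:
  assumes "x \<preceq> y" "z \<preceq> w" "x \<in> carrier G" "y \<in> carrier G" "z \<in> carrier G" "w \<in> carrier G"
  shows "x \<otimes> z \<preceq> y \<otimes> w"
proof -
  have "x \<otimes> z \<preceq> x \<otimes> w" using assms by (simp add: mult_lle_mono)
  moreover have "w \<otimes> x \<preceq> w \<otimes> y" using assms by (simp add: mult_lle_mono)
  ultimately show ?thesis
    using assms lle_trans[of "x \<otimes> z" "x \<otimes> w" "y \<otimes> w"] by (simp add: m_comm)
qed

lemma mult_pos: "\<lbrakk>\<one> \<preceq> x; \<one> \<preceq> y; x \<in> carrier G; y \<in> carrier G\<rbrakk> \<Longrightarrow> \<one> \<preceq> x \<otimes> y"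
  using mult_lle_mono2[of \<one> x \<one> y] by simp

lemma lle_mult_pos: "\<lbrakk>x \<preceq> y; \<one> \<preceq> z; x \<in> carrier G; y \<in> carrier G; z \<in> carrier G\<rbrakk> \<Longrightarrow> x \<preceq> y \<otimes> z"
  using mult_lle_mono2[of x y \<one> z] by simp

lemma lle_diff_iff:
  "\<lbrakk>x \<in> carrier G; y \<in> carrier G\<rbrakk> \<Longrightarrow> \<one> \<preceq> y \<otimes> inv x \<longleftrightarrow> x \<preceq> y"
  using mult_lle_mono[of \<one> "y \<otimes> inv x" x] mult_lle_mono[of x y "inv x"]
  by (auto simp: m_comm[of "inv x" y] m_lcomm[of x y])

lemma inv_lle_iff: "\<lbrakk>x \<in> carrier G; y \<in> carrier G\<rbrakk> \<Longrightarrow> inv x \<preceq> inv y \<longleftrightarrow> y \<preceq> x"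
  using lle_diff_iff[of "inv x" "inv y"] lle_diff_iff[of y x] by (simp add: m_comm)

lemma mult_meet_distrib:
  assumes x: "x \<in> carrier G" and y: "y \<in> carrier G" and z: "z \<in> carrier G"
  shows "z \<otimes> (x \<curlywedge> y) = (z \<otimes> x) \<curlywedge> (z \<otimes> y)"
proof (rule lle_antisym)
  show "z \<otimes> (x \<curlywedge> y) \<preceq> (z \<otimes> x) \<curlywedge> (z \<otimes> y)"
    using assms by (intro meet_greatest mult_lle_mono meet_lle1 meet_lle2) (auto simp: meet_closed)
  define w where "w = (z \<otimes> x) \<curlywedge> (z \<otimes> y)"
  have w: "w \<in> carrier G" using assms by (simp add: w_def meet_closed)
  have "inv z \<otimes> w \<preceq> inv z \<otimes> (z \<otimes> x)" "inv z \<otimes> w \<preceq> inv z \<otimes> (z \<otimes> y)"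
    using assms w by (auto simp: w_def intro!: mult_lle_mono meet_lle1 meet_lle2)
  then have "inv z \<otimes> w \<preceq> x" "inv z \<otimes> w \<preceq> y"
    using assms by (simp_all add: m_assoc[symmetric])
  then have "inv z \<otimes> w \<preceq> x \<curlywedge> y"
    using assms w by (intro meet_greatest) auto
  then have "z \<otimes> (inv z \<otimes> w) \<preceq> z \<otimes> (x \<curlywedge> y)"
    using assms w by (intro mult_lle_mono) (auto simp: meet_closed)
  then show "(z \<otimes> x) \<curlywedge> (z \<otimes> y) \<preceq> z \<otimes> (x \<curlywedge> y)"
    using assms w by (simp add: m_assoc[symmetric] w_def)
qed (use assms in \<open>auto simp: meet_closed\<close>)

lemma inv_join:
  assumes x: "x \<in> carrier G" and y: "y \<in> carrier G"
  shows "inv (x \<curlyvee> y) = inv x \<curlywedge> inv y"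
proof (rule lle_antisym)
  show "inv (x \<curlyvee> y) \<preceq> inv x \<curlywedge> inv y"
    using assms by (intro meet_greatest)
      (auto simp: inv_lle_iff join_closed join_lge1 join_lge2)
  have "inv (inv x) \<preceq> inv (inv x \<curlywedge> inv y)" "inv (inv y) \<preceq> inv (inv x \<curlywedge> inv y)"
    using assms by (auto simp only: inv_lle_iff meet_closed inv_closed meet_lle1 meet_lle2)
  then have "x \<curlyvee> y \<preceq> inv (inv x \<curlywedge> inv y)"
    using assms by (intro join_least) (auto simp: meet_closed)
  then have "inv (inv (inv x \<curlywedge> inv y)) \<preceq> inv (x \<curlyvee> y)"
    using assms by (subst inv_lle_iff) (auto simp: meet_closed join_closed)
  then show "inv x \<curlywedge> inv y \<preceq> inv (x \<curlyvee> y)"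
    using assms by (simp add: meet_closed)
qed (use assms in \<open>auto simp: meet_closed join_closed\<close>)

text \<open>The identity \<open>x + y = (x \<or> y) + (x \<and> y)\<close> in the case \<open>x \<and> y = 0\<close>.\<close>

lemma join_eq_mult_of_disjoint:
  assumes "x \<curlywedge> y = \<one>" and x: "x \<in> carrier G" and y: "y \<in> carrier G"
  shows "x \<curlyvee> y = x \<otimes> y"
proof -
  have "inv x \<curlyvee> inv y = inv (inv (inv x \<curlyvee> inv y))"
    using x y by (simp add: join_closed)
  also have "\<dots> = \<one>" using assms by (simp add: inv_join)
  finally have *: "inv x \<curlyvee> inv y = \<one>" .
  have "x \<otimes> y = (x \<otimes> y) \<otimes> (inv x \<curlyvee> inv y)"
    using x y by (simp add: *)
  also have "\<dots> = y \<curlyvee> x"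
    using x y by (simp add: mult_join_distrib m_assoc) (simp add: m_lcomm[of x y])
  finally show ?thesis using x y by (simp add: join_comm)
qed

text \<open>If \<open>t \<le> x\<close> and \<open>t \<le> y + z\<close>, then \<open>t \<le> (x + z) \<and> (y + z) = (x \<and> y) + z = z\<close>, hence
\<open>t \<le> x \<and> z = 0\<close>.\<close>

lemma disjoint_mult:
  assumes "x \<curlywedge> y = \<one>" "x \<curlywedge> z = \<one>"
    and x: "x \<in> carrier G" and y: "y \<in> carrier G" and z: "z \<in> carrier G"
  shows "x \<curlywedge> (y \<otimes> z) = \<one>"
proof -
  have pos: "\<one> \<preceq> x" "\<one> \<preceq> y" "\<one> \<preceq> z"
    using meet_lle1[OF x y] meet_lle2[OF x y] meet_lle2[OF x z] assms by auto
  define t where "t = x \<curlywedge> (y \<otimes> z)"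
  have t: "t \<in> carrier G" using x y z by (simp add: t_def meet_closed)
  have tx: "t \<preceq> x" and tyz: "t \<preceq> y \<otimes> z"
    using x y z by (auto simp: t_def meet_lle1 meet_lle2)
  have "t \<preceq> z \<otimes> x"
    using lle_mult_pos[OF tx pos(3) t x z] x z by (simp add: m_comm)
  moreover have "t \<preceq> z \<otimes> y" using tyz y z by (simp add: m_comm)
  ultimately have "t \<preceq> (z \<otimes> x) \<curlywedge> (z \<otimes> y)"
    using x y z t by (intro meet_greatest) auto
  then have "t \<preceq> z" using x y z assms by (simp add: mult_meet_distrib[symmetric])
  then have "t \<preceq> x \<curlywedge> z" using tx x z t by (intro meet_greatest)
  then have "t \<preceq> \<one>" using assms by simp
  moreover have "\<one> \<preceq> t"
    unfolding t_def using pos x y z by (intro meet_greatest mult_pos) auto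
  ultimately have "t = \<one>" using t by (intro lle_antisym) auto
  then show ?thesis by (simp add: t_def)
qed

lemma disjoint_comm: "\<lbrakk>x \<curlywedge> y = \<one>; x \<in> carrier G; y \<in> carrier G\<rbrakk> \<Longrightarrow> y \<curlywedge> x = \<one>"
  by (simp add: meet_comm)

lemma disjoint_pow:
  fixes n :: nat
  assumes "x \<curlywedge> y = \<one>" and x: "x \<in> carrier G" and y: "y \<in> carrier G"
  shows "x \<curlywedge> y [^] n = \<one>"
proof (induction n)
  case 0
  have "\<one> \<preceq> x" using meet_lle1[OF x y] assms by simp
  then show ?case using x by (simp add: lle_def meet_comm)
next
  case (Suc n)
  then show ?case using disjoint_mult[of x "y [^] n" y] assms by simp
qed

lemma disjoint_finprod:
  assumes "finite I" "x \<in> carrier G" "\<one> \<preceq> x" "\<And>i. i \<in> I \<Longrightarrow> f i \<in> carrier G"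
    "\<And>i. i \<in> I \<Longrightarrow> x \<curlywedge> f i = \<one>"
  shows "x \<curlywedge> finprod G f I = \<one>"
  using assms
proof (induction I rule: finite_induct)
  case empty
  then show ?case by (simp add: lle_def meet_comm)
next
  case (insert i I)
  then show ?case by (simp add: Pi_iff disjoint_mult)
qed

lemma nat_pow_pos: "\<lbrakk>\<one> \<preceq> x; x \<in> carrier G\<rbrakk> \<Longrightarrow> \<one> \<preceq> x [^] (n::nat)"
  by (induction n) (auto intro: mult_pos)

lemma nat_pow_lle_exp:
  assumes "\<one> \<preceq> x" "x \<in> carrier G" "m \<le> (n::nat)"
  shows "x [^] m \<preceq> x [^] n"
proof -
  have "x [^] n = x [^] m \<otimes> x [^] (n - m)" using assms by (simp add: nat_pow_mult)
  then show ?thesis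
    using assms lle_mult_pos[of "x [^] m" "x [^] m" "x [^] (n - m)"] by (simp add: nat_pow_pos)
qed

lemma nat_pow_mono:
  assumes "x \<preceq> y" "x \<in> carrier G" "y \<in> carrier G"
  shows "x [^] (n::nat) \<preceq> y [^] n"
  using assms by (induction n) (auto intro: mult_lle_mono2)

lemma finprod_pos:
  assumes "\<And>i. i \<in> I \<Longrightarrow> \<one> \<preceq> f i" "\<And>i. i \<in> I \<Longrightarrow> f i \<in> carrier G"
  shows "\<one> \<preceq> finprod G f I"
  using assms
proof (induction I rule: infinite_finite_induct)
  case (insert i I)
  then show ?case by (simp add: Pi_iff mult_pos)
qed auto

lemma finprod_mono:
  assumes "\<And>i. i \<in> I \<Longrightarrow> f i \<preceq> g i" "\<And>i. i \<in> I \<Longrightarrow> f i \<in> carrier G"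
    "\<And>i. i \<in> I \<Longrightarrow> g i \<in> carrier G"
  shows "finprod G f I \<preceq> finprod G g I"
  using assms
proof (induction I rule: infinite_finite_induct)
  case (insert i I)
  then show ?case by (simp add: Pi_iff mult_lle_mono2)
qed auto

lemma lle_finprod:
  assumes "finite I" "i \<in> I" "\<And>i. i \<in> I \<Longrightarrow> \<one> \<preceq> f i" "\<And>i. i \<in> I \<Longrightarrow> f i \<in> carrier G"
  shows "f i \<preceq> finprod G f I"
proof -
  have "insert i (I - {i}) = I" using assms by auto
  then have "finprod G f I = f i \<otimes> finprod G f (I - {i})"
    using finprod_insert[of "I - {i}" i f] assms by (simp add: Pi_iff)
  then show ?thesis
    using assms lle_mult_pos[of "f i" "f i" "finprod G f (I - {i})"]
      finprod_pos[of "I - {i}" f] by (auto simp: Pi_iff)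
qed

text \<open>Subtracting the common part of two elements leaves disjoint elements: translation by
  \<open>x \<curlywedge> y\<close> carries infima to infima.\<close>

lemma diff_meet_disjoint:
  assumes x: "x \<in> carrier G" and y: "y \<in> carrier G"
  shows "(x \<otimes> inv (x \<curlywedge> y)) \<curlywedge> (y \<otimes> inv (x \<curlywedge> y)) = \<one>"
  using mult_meet_distrib[of x y "inv (x \<curlywedge> y)"] x y by (simp add: meet_closed m_comm)

end

section \<open>Terms and fans\<close>

text \<open>A finitely generated $\ell$-group is studied through the $\ell$-group words in its generators. The
same word is evaluated in three places: at integer points (\<open>lev\<close>), at real points (\<open>lev\<close> again), and
at a tuple of elements of an $\ell$-group (\<open>ev\<close>). As a function on the cone, a word is piecewise linear
and positively homogeneous.\<close>

datatype lterm = Var nat | Zero | Neg lterm | Add lterm lterm | Join lterm lterm | Meet lterm lterm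

instance lterm :: countable
  by countable_datatype

primrec lev :: "(nat \<Rightarrow> 'r::linordered_idom) \<Rightarrow> lterm \<Rightarrow> 'r" where
  "lev x (Var i) = x i"
| "lev x Zero = 0"
| "lev x (Neg t) = - lev x t"
| "lev x (Add s t) = lev x s + lev x t"
| "lev x (Join s t) = max (lev x s) (lev x t)"
| "lev x (Meet s t) = min (lev x s) (lev x t)"

primrec ev :: "('a, 'm) lgroup_scheme \<Rightarrow> (nat \<Rightarrow> 'a) \<Rightarrow> lterm \<Rightarrow> 'a" where
  "ev G a (Var i) = a i"
| "ev G a Zero = \<one>\<^bsub>G\<^esub>"
| "ev G a (Neg t) = inv\<^bsub>G\<^esub> (ev G a t)"
| "ev G a (Add s t) = ev G a s \<otimes>\<^bsub>G\<^esub> ev G a t"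
| "ev G a (Join s t) = ev G a s \<curlyvee>\<^bsub>G\<^esub> ev G a t"
| "ev G a (Meet s t) = ev G a s \<curlywedge>\<^bsub>G\<^esub> ev G a t"

lemma lev_of_int: "lev (\<lambda>i. of_int (p i)) t = of_int (lev p t)"
  by (induction t) (auto simp: max_def min_def)

lemma lev_scale:
  fixes c :: "'r::linordered_idom"
  assumes "c \<ge> 0" shows "lev (\<lambda>i. c * x i) t = c * lev x t"
  using assms
  by (induction t) (simp_all add: algebra_simps max_mult_distrib_left min_mult_distrib_left)

text \<open>A unimodular fan in $\mathbb{R}^n$, kept combinatorially: vertices \<open>0, \<dots>, nv - 1\<close>, the abstract
simplicial complex \<open>cx\<close> of its cones, the primitive integer vector \<open>pt v\<close> on the ray of the vertex \<open>v\<close>,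
and a word \<open>hat v\<close> for the Schauder hat of \<open>v\<close>, the function that is linear on every cone, \<open>1\<close> at
\<open>pt v\<close> and \<open>0\<close> at the other vertices.\<close>

datatype fan = Fan (nv: nat) (cx: "nat set set") (pt: "nat \<Rightarrow> nat \<Rightarrow> int") (hat: "nat \<Rightarrow> lterm")

definition orthant_fan :: "nat \<Rightarrow> fan" where
  "orthant_fan n = Fan n (Pow {..<n}) (\<lambda>v i. if i = v then 1 else 0) Var"

text \<open>Subdivision of the edge \<open>{v, w}\<close> at the sum of its two integer vectors, which keeps all cones
unimodular. On the hats this is an $\ell$-group operation: on the cones that contain the edge, the minimum of
the two old hats is \<open>1\<close> at the new vertex and linear on both halves.\<close>

definition star :: "nat \<Rightarrow> nat \<Rightarrow> fan \<Rightarrow> fan" where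
  "star v w F = (let z = nv F; b = Meet (hat F v) (hat F w) in
     Fan (Suc z)
       ({S \<in> cx F. \<not> {v, w} \<subseteq> S} \<union> {insert z T |T. T \<union> {v, w} \<in> cx F \<and> \<not> {v, w} \<subseteq> T})
       ((pt F)(z := \<lambda>i. pt F v i + pt F w i))
       ((hat F)(v := Add (hat F v) (Neg b), w := Add (hat F w) (Neg b), z := b)))"

inductive star_step :: "fan \<Rightarrow> fan \<Rightarrow> bool" where
  "\<lbrakk>v \<noteq> w; {v, w} \<in> cx F\<rbrakk> \<Longrightarrow> star_step F (star v w F)"

abbreviation refines :: "fan \<Rightarrow> fan \<Rightarrow> bool" where
  "refines \<equiv> star_step\<^sup>*\<^sup>*"

definition wf_fan :: "fan \<Rightarrow> bool" where
  "wf_fan F \<longleftrightarrow> (\<forall>S\<in>cx F. S \<subseteq> {..<nv F} \<and> (\<forall>T\<subseteq>S. T \<in> cx F)) \<and> (\<forall>v<nv F. {v} \<in> cx F)"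

lemma wf_orthant_fan: "wf_fan (orthant_fan n)"
  by (auto simp: wf_fan_def orthant_fan_def)

lemma star_simps [simp]:
  "nv (star v w F) = Suc (nv F)"
  "cx (star v w F) = {S \<in> cx F. \<not> {v, w} \<subseteq> S} \<union>
     {insert (nv F) T |T. T \<union> {v, w} \<in> cx F \<and> \<not> {v, w} \<subseteq> T}"
  "pt (star v w F) = (pt F)(nv F := \<lambda>i. pt F v i + pt F w i)"
  "hat (star v w F) = (let b = Meet (hat F v) (hat F w) in
     (hat F)(v := Add (hat F v) (Neg b), w := Add (hat F w) (Neg b), nv F := b))"
  by (simp_all add: star_def Let_def)

lemma wf_fan_less: "\<lbrakk>wf_fan F; S \<in> cx F; v \<in> S\<rbrakk> \<Longrightarrow> v < nv F"
  by (auto simp: wf_fan_def)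

lemma wf_fan_down: "\<lbrakk>wf_fan F; S \<in> cx F; T \<subseteq> S\<rbrakk> \<Longrightarrow> T \<in> cx F"
  by (auto simp: wf_fan_def)

lemma wf_fan_star:
  assumes wf: "wf_fan F" and "v \<noteq> w" and e: "{v, w} \<in> cx F"
  shows "wf_fan (star v w F)"
  unfolding wf_fan_def
proof (intro conjI ballI allI impI)
  fix S assume S: "S \<in> cx (star v w F)"
  show "S \<subseteq> {..<nv (star v w F)}"
    using S wf_fan_less[OF wf] by (fastforce simp: less_Suc_eq)
  fix T assume T: "T \<subseteq> S"
  show "T \<in> cx (star v w F)"
  proof (cases "S \<in> cx F \<and> \<not> {v, w} \<subseteq> S")
    case True
    then show ?thesis using T wf_fan_down[OF wf, of S T] by auto
  next
    case False
    then obtain U where U: "S = insert (nv F) U" "U \<union> {v, w} \<in> cx F" "\<not> {v, w} \<subseteq> U"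
      using S by auto
    show ?thesis
    proof (cases "nv F \<in> T")
      case True
      define T' where "T' = T - {nv F}"
      have "T = insert (nv F) T'" "T' \<subseteq> U" using True T U by (auto simp: T'_def)
      moreover have "T' \<union> {v, w} \<in> cx F"
        using \<open>T' \<subseteq> U\<close> U(2) by (rule_tac wf_fan_down[OF wf, of "U \<union> {v, w}"]) auto
      ultimately show ?thesis using U(3) by auto
    next
      case False
      then have "T \<subseteq> U" using T U by auto
      then have "T \<in> cx F" using U(2) wf_fan_down[OF wf, of "U \<union> {v, w}" T] by auto
      then show ?thesis using \<open>T \<subseteq> U\<close> U(3) by auto
    qed
  qed
next
  fix x assume x: "x < nv (star v w F)"
  show "{x} \<in> cx (star v w F)"
  proof (cases "x = nv F")
    case True
    then show ?thesis using e by (auto intro!: exI[of _ "{}"])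
  next
    case False
    then have "{x} \<in> cx F" using x wf by (auto simp: wf_fan_def)
    then show ?thesis using \<open>v \<noteq> w\<close> by auto
  qed
qed

lemma refines_wf: "\<lbrakk>refines F F'; wf_fan F\<rbrakk> \<Longrightarrow> wf_fan F'"
  by (induction rule: rtranclp_induct) (auto elim!: star_step.cases intro: wf_fan_star simp del: star_simps)

lemma star_edge_cases:
  assumes wf: "wf_fan F" and "v \<noteq> w" and e: "{v, w} \<in> cx F" and ab: "{a, b} \<in> cx (star v w F)"
  obtains "a < nv F" "b < nv F" "{a, b} \<in> cx F" "\<not> {v, w} \<subseteq> {a, b}"
  | "a = nv F" "b = nv F"
  | "a = nv F" "b < nv F" "{v, b} \<in> cx F" "{w, b} \<in> cx F"
  | "b = nv F" "a < nv F" "{v, a} \<in> cx F" "{w, a} \<in> cx F"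
proof (cases "{a, b} \<in> cx F \<and> \<not> {v, w} \<subseteq> {a, b}")
  case True
  then show ?thesis using that(1) wf_fan_less[OF wf, of "{a, b}"] by auto
next
  case False
  then obtain U where U: "{a, b} = insert (nv F) U" "U \<union> {v, w} \<in> cx F"
    using ab by auto
  have N: "nv F \<notin> U" using wf_fan_less[OF wf U(2)] by auto
  have *: "x < nv F \<and> {v, x} \<in> cx F \<and> {w, x} \<in> cx F" if "x \<in> U" for x
    using that wf_fan_less[OF wf U(2)] wf_fan_down[OF wf U(2), of "{v, x}"]
      wf_fan_down[OF wf U(2), of "{w, x}"] by auto
  have "a = nv F \<or> b = nv F" using U(1) by (metis insertI1 insert_iff singletonD)
  moreover have "a \<noteq> nv F \<Longrightarrow> a \<in> U" "b \<noteq> nv F \<Longrightarrow> b \<in> U" using U(1) by auto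
  ultimately show ?thesis using that * by metis
qed

subsection \<open>Linearity of a term on a fan\<close>

text \<open>Whether a word is linear on every cone can be read off along the edges: a supremum of two functions
  that are linear on a cone is linear there if and only if their difference does not change sign
  between two vertices of the cone.\<close>

definition no_sign_change :: "fan \<Rightarrow> (nat \<Rightarrow> int) \<Rightarrow> bool" where
  "no_sign_change F d \<longleftrightarrow> (\<forall>v w. {v, w} \<in> cx F \<longrightarrow> \<not> (d v > 0 \<and> d w < 0))"

abbreviation gap :: "fan \<Rightarrow> lterm \<Rightarrow> lterm \<Rightarrow> nat \<Rightarrow> int" where
  "gap F s t \<equiv> \<lambda>v. lev (pt F v) s - lev (pt F v) t"

fun lin :: "fan \<Rightarrow> lterm \<Rightarrow> bool" where
  "lin F (Var i) = True"
| "lin F Zero = True"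
| "lin F (Neg t) = lin F t"
| "lin F (Add s t) = (lin F s \<and> lin F t)"
| "lin F (Join s t) = (lin F s \<and> lin F t \<and> no_sign_change F (gap F s t))"
| "lin F (Meet s t) = (lin F s \<and> lin F t \<and> no_sign_change F (gap F s t))"

lemma lev_edge:
  assumes "lin F t" and e: "{v, w} \<in> cx F"
  shows "lev (\<lambda>i. pt F v i + pt F w i) t = lev (pt F v) t + lev (pt F w) t"
  using assms(1)
proof (induction t)
  case (Join s t)
  then show ?case using e insert_commute[of v w "{}"]
    by (auto simp: no_sign_change_def max_def) (smt (verit))+
next
  case (Meet s t)
  then show ?case using e insert_commute[of v w "{}"]
    by (auto simp: no_sign_change_def min_def) (smt (verit))+
qed auto

lemma gap_star:
  assumes "lin F s" "lin F t" "{v, w} \<in> cx F"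
  shows "gap (star v w F) s t = (gap F s t)(nv F := gap F s t v + gap F s t w)"
  using lev_edge[OF assms(1,3)] lev_edge[OF assms(2,3)] by (auto simp: fun_eq_iff)

text \<open>The new vertex lies on an edge without sign change, so its value has the sign of one of the endpoints,
and every neighbour of the new vertex is a neighbour of both endpoints.\<close>

lemma no_sign_change_star:
  assumes wf: "wf_fan F" "v \<noteq> w" and e: "{v, w} \<in> cx F" and d: "no_sign_change F d"
  shows "no_sign_change (star v w F) (d(nv F := d v + d w))"
proof -
  have D: "\<not> (d a > 0 \<and> d b < 0)" "\<not> (d b > 0 \<and> d a < 0)" if "{a, b} \<in> cx F" for a b
    using d that unfolding no_sign_change_def by (metis insert_commute)+
  show ?thesis
    unfolding no_sign_change_def
  proof (intro allI impI)
    fix a b assume ab: "{a, b} \<in> cx (star v w F)"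
    from wf e ab show "\<not> (0 < (d(nv F := d v + d w)) a \<and> (d(nv F := d v + d w)) b < 0)"
    proof (cases rule: star_edge_cases)
      case 3
      then show ?thesis using D[of v b] D[of w b] by auto
    next
      case 4
      then show ?thesis using D[of v a] D[of w a] by auto
    qed (use D[of a b] in auto)
  qed
qed

lemma lin_star:
  assumes "wf_fan F" "v \<noteq> w" "{v, w} \<in> cx F" "lin F t"
  shows "lin (star v w F) t"
  using assms(4)
  by (induction t)
    (use no_sign_change_star[OF assms(1-3)] gap_star[OF _ _ assms(3)] in \<open>auto simp del: star_simps\<close>)

lemma refines_lin: "\<lbrakk>refines F F'; wf_fan F; lin F t\<rbrakk> \<Longrightarrow> lin F' t"
proof (induction rule: rtranclp_induct)
  case (step F' F'')
  then show ?case using refines_wf[of F F'] by (auto elim!: star_step.cases intro: lin_star simp del: star_simps)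
qed

definition bad_edges :: "fan \<Rightarrow> (nat \<Rightarrow> int) \<Rightarrow> (nat \<times> nat) set" where
  "bad_edges F d = {(a, b). {a, b} \<in> cx F \<and> d a > 0 \<and> d b < 0}"

lemma finite_bad_edges: "wf_fan F \<Longrightarrow> finite (bad_edges F d)"
  by (rule finite_subset[of _ "{..<nv F} \<times> {..<nv F}"])
    (auto simp: bad_edges_def dest: wf_fan_less)

text \<open>The descent behind the resolution of sign changes. Subdivide a bad edge \<open>{v, w}\<close> of greatest drop
\<open>d v - d w\<close>. A bad edge through the new vertex, of value \<open>d v + d w\<close>, has a drop smaller than that of
the edge joining its other end to \<open>v\<close> or \<open>w\<close>; that edge was bad, hence of drop at most \<open>d v - d w\<close>.\<close>

lemma bad_edges_star:
  assumes wf: "wf_fan F" "v \<noteq> w" and e: "{v, w} \<in> cx F"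
    and vw: "(v, w) \<in> bad_edges F d" "\<And>a b. (a, b) \<in> bad_edges F d \<Longrightarrow> d a - d b \<le> d v - d w"
    and ab: "(a, b) \<in> bad_edges (star v w F) d'" and d': "d' = d(nv F := d v + d w)"
  shows "((a, b) \<in> bad_edges F d \<and> (a, b) \<noteq> (v, w) \<and> d' a - d' b = d a - d b) \<or>
    d' a - d' b < d v - d w"
proof -
  have ab': "{a, b} \<in> cx (star v w F)" "d' a > 0" "d' b < 0" using ab by (auto simp: bad_edges_def)
  have v: "d v > 0" "d w < 0" using vw by (auto simp: bad_edges_def)
  from wf e ab'(1) show ?thesis
  proof (cases rule: star_edge_cases)
    case 3
    then show ?thesis using vw(2)[of v b] v ab' d' by (auto simp: bad_edges_def)
  next
    case 4
    then show ?thesis using vw(2)[of a w] v ab' d' insert_commute[of w a "{}"]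
      by (auto simp: bad_edges_def)
  qed (use ab' d' in \<open>auto simp: bad_edges_def\<close>)
qed

text \<open>Induction on a bound \<open>W\<close> for the drops and, for fixed \<open>W\<close>, on the number of bad edges that attain it:
each subdivision removes one of these and creates only bad edges of smaller drop.\<close>

lemma resolve_aux:
  assumes "wf_fan F" "lin F s" "lin F t"
    "\<And>a b. (a, b) \<in> bad_edges F (gap F s t) \<Longrightarrow> gap F s t a - gap F s t b \<le> int W"
  shows "\<exists>F'. refines F F' \<and> no_sign_change F' (gap F' s t)"
  using assms
proof (induction W arbitrary: F)
  case 0
  then have "no_sign_change F (gap F s t)"
    unfolding no_sign_change_def bad_edges_def by fastforce
  then show ?case by blast
next
  case (Suc W)
  define M where "M F = {(a, b) \<in> bad_edges F (gap F s t). gap F s t a - gap F s t b = int (Suc W)}" for F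
  from Suc.prems show ?case
  proof (induction "card (M F)" arbitrary: F rule: less_induct)
    case less
    let ?d = "gap F s t"
    show ?case
    proof (cases "M F = {}")
      case True
      have "?d a - ?d b \<le> int W" if "(a, b) \<in> bad_edges F ?d" for a b
        using less.prems(4)[OF that] True that by (force simp: M_def)
      then show ?thesis using Suc.IH less.prems by blast
    next
      case False
      then obtain v w where vw: "(v, w) \<in> bad_edges F ?d" "?d v - ?d w = int (Suc W)"
        by (auto simp: M_def)
      have e: "{v, w} \<in> cx F" "v \<noteq> w" using vw by (auto simp: bad_edges_def)
      define F' where "F' = star v w F"
      have g: "gap F' s t = ?d(nv F := ?d v + ?d w)"
        unfolding F'_def by (rule gap_star[OF less.prems(2,3) e(1)])
      have *: "((a, b) \<in> bad_edges F ?d \<and> (a, b) \<noteq> (v, w) \<and> gap F' s t a - gap F' s t b = ?d a - ?d b) \<or>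
        gap F' s t a - gap F' s t b < int (Suc W)" if "(a, b) \<in> bad_edges F' (gap F' s t)" for a b
      proof -
        have "?d a - ?d b \<le> ?d v - ?d w" if "(a, b) \<in> bad_edges F ?d" for a b
          using less.prems(4)[OF that] vw(2) by linarith
        then show ?thesis
          using bad_edges_star[OF less.prems(1) e(2,1) vw(1) _ that[unfolded F'_def]
              g[unfolded F'_def]] vw(2)
          unfolding F'_def[symmetric] by auto
      qed
      have wf': "wf_fan F'" using wf_fan_star less.prems e by (auto simp: F'_def simp del: star_simps)
      have "M F' \<subseteq> M F - {(v, w)}"
        using * unfolding M_def by fastforce
      moreover have "(v, w) \<in> M F" using vw by (auto simp: M_def)
      moreover have "finite (M F)"
        using finite_bad_edges[OF less.prems(1), of ?d] by (rule finite_subset[rotated]) (auto simp: M_def)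
      ultimately have "card (M F') < card (M F)" by (intro psubset_card_mono) auto
      moreover have "gap F' s t a - gap F' s t b \<le> int (Suc W)"
        if "(a, b) \<in> bad_edges F' (gap F' s t)" for a b
        using *[OF that] less.prems(4)[of a b] by linarith
      ultimately obtain F'' where "refines F' F''" "no_sign_change F'' (gap F'' s t)"
        using less.hyps[of F'] wf' lin_star[OF less.prems(1) e(2,1)] less.prems(2,3)
        unfolding F'_def[symmetric] by blast
      moreover have "star_step F F'" unfolding F'_def using e by (intro star_step.intros)
      ultimately show ?thesis by (meson converse_rtranclp_into_rtranclp)
    qed
  qed
qed

lemma resolve:
  assumes "wf_fan F" "lin F s" "lin F t"
  shows "\<exists>F'. refines F F' \<and> no_sign_change F' (gap F' s t)"
proof -
  let ?B = "bad_edges F (gap F s t)"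
  define W where "W = Max (insert 0 ((\<lambda>(a, b). nat (gap F s t a - gap F s t b)) ` ?B))"
  have "gap F s t a - gap F s t b \<le> int W" if "(a, b) \<in> ?B" for a b
  proof -
    have "nat (gap F s t a - gap F s t b) \<le> W"
      unfolding W_def using that finite_bad_edges[OF assms(1)] by (intro Max_ge) force+
    then show ?thesis by linarith
  qed
  then show ?thesis using resolve_aux[OF assms] by blast
qed

text \<open>The theorem of De Concini and Procesi in the form needed here: edge subdivisions alone
suffice to make any piecewise linear function linear on the cones.\<close>

lemma exists_refinement_lin:
  assumes "wf_fan F" shows "\<exists>F'. refines F F' \<and> lin F' t"
proof -
  have two: "\<exists>F'. refines F F' \<and> lin F' s \<and> lin F' t \<and> no_sign_change F' (gap F' s t)"
    if s: "\<And>F. wf_fan F \<Longrightarrow> \<exists>F'. refines F F' \<and> lin F' s"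
      and t: "\<And>F. wf_fan F \<Longrightarrow> \<exists>F'. refines F F' \<and> lin F' t" and F: "wf_fan F" for F s t
  proof -
    obtain F1 where 1: "refines F F1" "lin F1 s" using s F by blast
    have w1: "wf_fan F1" using 1 F refines_wf by blast
    obtain F2 where 2: "refines F1 F2" "lin F2 t" using t w1 by blast
    have w2: "wf_fan F2" "lin F2 s" using 1 2 w1 refines_wf refines_lin by blast+
    obtain F3 where 3: "refines F2 F3" "no_sign_change F3 (gap F3 s t)" using resolve w2 2 by blast
    have "lin F3 s" "lin F3 t" using refines_lin[OF 3(1) w2(1)] w2(2) 2(2) by blast+
    then show ?thesis using 1(1) 2(1) 3 by (meson rtranclp_trans)
  qed
  show ?thesis using assms
  proof (induction t arbitrary: F)
    case (Add s t)
    then show ?case using two[of s t F] by (metis lin.simps(4))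
  next
    case (Join s t)
    then show ?case using two[of s t F] by (metis lin.simps(5))
  next
    case (Meet s t)
    then show ?case using two[of s t F] by (metis lin.simps(6))
  qed auto
qed

section \<open>Fans as decompositions of an $\ell$-group\<close>

context lgroup
begin

definition lincomb :: "nat \<Rightarrow> (nat \<Rightarrow> 'a) \<Rightarrow> (nat \<Rightarrow> int) \<Rightarrow> 'a" where
  "lincomb N h c = (\<Otimes>v\<in>{..<N}. h v [^] c v)"

lemma lincomb_closed [simp]: "(\<And>v. v < N \<Longrightarrow> h v \<in> carrier G) \<Longrightarrow> lincomb N h c \<in> carrier G"
  by (simp add: lincomb_def Pi_iff)

lemma lincomb_cong:
  "(\<And>v. v < N \<Longrightarrow> h v \<in> carrier G) \<Longrightarrow> (\<And>v. v < N \<Longrightarrow> c v = d v) \<Longrightarrow> lincomb N h c = lincomb N h d"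
  unfolding lincomb_def by (rule finprod_cong') auto

lemma lincomb_add:
  assumes "\<And>v. v < N \<Longrightarrow> h v \<in> carrier G"
  shows "lincomb N h (\<lambda>v. c v + d v) = lincomb N h c \<otimes> lincomb N h d"
proof -
  have "lincomb N h (\<lambda>v. c v + d v) = (\<Otimes>v\<in>{..<N}. h v [^] c v \<otimes> h v [^] d v)"
    unfolding lincomb_def using assms by (intro finprod_cong') (auto simp: int_pow_mult)
  also have "\<dots> = lincomb N h c \<otimes> lincomb N h d"
    unfolding lincomb_def using assms by (intro finprod_multf) auto
  finally show ?thesis .
qed

lemma lincomb_zero:
  "(\<And>v. v < N \<Longrightarrow> h v \<in> carrier G) \<Longrightarrow> (\<And>v. v < N \<Longrightarrow> c v \<noteq> 0 \<Longrightarrow> h v = \<one>) \<Longrightarrow>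
    lincomb N h c = \<one>"
  unfolding lincomb_def by (rule finprod_one_eqI) (metis int_pow_0 int_pow_one lessThan_iff)

lemma lincomb_minus:
  assumes "\<And>v. v < N \<Longrightarrow> h v \<in> carrier G"
  shows "lincomb N h (\<lambda>v. - c v) = inv (lincomb N h c)"
proof -
  have "lincomb N h c \<otimes> lincomb N h (\<lambda>v. - c v) = \<one>"
    using lincomb_add[where N=N and h=h and c=c and d="\<lambda>v. - c v"]
      lincomb_zero[where N=N and h=h and c="\<lambda>v. 0"] assms by simp
  then show ?thesis using assms by (intro inv_equality[symmetric]) (auto simp: m_comm)
qed

lemma int_pow_pos:
  assumes "\<one> \<preceq> x" "x \<in> carrier G" "(c::int) \<ge> 0" shows "\<one> \<preceq> x [^] c"
  using assms nat_pow_pos[of x "nat c"] by (cases c) (auto simp: int_pow_int)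

lemma disjoint_int_pow:
  assumes "x \<curlywedge> y = \<one>" "x \<in> carrier G" "y \<in> carrier G" "(c::int) \<ge> 0"
  shows "x \<curlywedge> y [^] c = \<one>"
  using assms disjoint_pow[of x y "nat c"] by (cases c) (auto simp: int_pow_int)

lemma lincomb_pos:
  assumes "\<And>v. v < N \<Longrightarrow> h v \<in> carrier G" "\<And>v. v < N \<Longrightarrow> \<one> \<preceq> h v" "\<And>v. v < N \<Longrightarrow> c v \<ge> 0"
  shows "\<one> \<preceq> lincomb N h c"
  unfolding lincomb_def using assms by (intro finprod_pos) (auto intro: int_pow_pos)

lemma meet_one_left: "\<lbrakk>\<one> \<preceq> x; x \<in> carrier G\<rbrakk> \<Longrightarrow> \<one> \<curlywedge> x = \<one>"
  by (simp add: lle_def)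

lemma disjoint_lincomb:
  assumes h: "\<And>v. v < N \<Longrightarrow> h v \<in> carrier G" "\<And>v. v < N \<Longrightarrow> \<one> \<preceq> h v"
    and c: "\<And>v. v < N \<Longrightarrow> c v \<ge> 0" and d: "\<And>v. v < N \<Longrightarrow> d v \<ge> 0"
    and disj: "\<And>v w. v < N \<Longrightarrow> w < N \<Longrightarrow> c v > 0 \<Longrightarrow> d w > 0 \<Longrightarrow> h v \<curlywedge> h w = \<one>"
  shows "lincomb N h c \<curlywedge> lincomb N h d = \<one>"
proof -
  have 1: "h v [^] c v \<curlywedge> h w [^] d w = \<one>" if "v < N" "w < N" for v w
  proof (cases "c v = 0 \<or> d w = 0")
    case True
    have X: "h v [^] c v \<in> carrier G" "h w [^] d w \<in> carrier G" using h that by auto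
    have "\<one> \<curlywedge> h v [^] c v = \<one>" "\<one> \<curlywedge> h w [^] d w = \<one>"
      using X by (auto intro!: meet_one_left int_pow_pos h c d that)
    then have "h v [^] c v \<curlywedge> \<one> = \<one>" "\<one> \<curlywedge> h w [^] d w = \<one>"
      using X disjoint_comm[of \<one> "h v [^] c v"] by auto
    then show ?thesis using True by (metis int_pow_0)
  next
    case False
    then have "c v > 0" "d w > 0" using c d that by (auto simp: le_less)
    then have "h v \<curlywedge> h w [^] d w = \<one>"
      using disj[OF that] h that by (intro disjoint_int_pow) auto
    then have "h w [^] d w \<curlywedge> h v = \<one>"
      by (rule disjoint_comm) (use h that in auto)
    then have "h w [^] d w \<curlywedge> h v [^] c v = \<one>"
      by (rule disjoint_int_pow) (use h that \<open>c v > 0\<close> in auto)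
    then show ?thesis by (rule disjoint_comm) (use h that in auto)
  qed
  have 2: "h v [^] c v \<curlywedge> lincomb N h d = \<one>" if "v < N" for v
    unfolding lincomb_def using 1[OF that] h c that by (intro disjoint_finprod) (auto intro: int_pow_pos)
  have "lincomb N h d \<curlywedge> lincomb N h c = \<one>"
    unfolding lincomb_def[of N h c] using 2 h d lincomb_pos[OF h d]
    by (intro disjoint_finprod) (auto intro!: disjoint_comm[OF 2])
  then show ?thesis by (rule disjoint_comm) (use h in auto)
qed

text \<open>Subtract the combination with coefficients \<open>min c d\<close> from both: the remainders have no common vertex
and, by disjointness, infimum \<open>0\<close>; so their supremum is their sum.\<close>

lemma lincomb_join_meet:
  assumes h: "\<And>v. v < N \<Longrightarrow> h v \<in> carrier G" "\<And>v. v < N \<Longrightarrow> \<one> \<preceq> h v"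
    and disj: "\<And>v w. v < N \<Longrightarrow> w < N \<Longrightarrow> c v > d v \<Longrightarrow> c w < d w \<Longrightarrow> h v \<curlywedge> h w = \<one>"
  shows "lincomb N h c \<curlyvee> lincomb N h d = lincomb N h (\<lambda>v. max (c v) (d v))"
    and "lincomb N h c \<curlywedge> lincomb N h d = lincomb N h (\<lambda>v. min (c v) (d v))"
proof -
  define L where "L = lincomb N h"
  define m where "m v = min (c v) (d v)" for v
  define p where "p v = c v - m v" for v
  define q where "q v = d v - m v" for v
  have cl: "L e \<in> carrier G" for e using h by (simp add: L_def)
  have c: "L c = L m \<otimes> L p" and d: "L d = L m \<otimes> L q"
    unfolding L_def using h by (simp_all add: lincomb_add[symmetric] p_def q_def)
  have mx: "L (\<lambda>v. max (c v) (d v)) = L m \<otimes> (L p \<otimes> L q)"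
    unfolding L_def using h
    by (simp add: lincomb_add[symmetric]) (intro lincomb_cong, auto simp: p_def q_def m_def)
  have pq: "L p \<curlywedge> L q = \<one>"
    unfolding L_def using h disj by (intro disjoint_lincomb) (auto simp: p_def q_def m_def min_def split: if_splits)
  show "lincomb N h c \<curlyvee> lincomb N h d = lincomb N h (\<lambda>v. max (c v) (d v))"
    using mx cl join_eq_mult_of_disjoint[OF pq] unfolding L_def[symmetric] c d
    by (simp add: mult_join_distrib[symmetric])
  show "lincomb N h c \<curlywedge> lincomb N h d = lincomb N h (\<lambda>v. min (c v) (d v))"
    using cl pq unfolding L_def[symmetric] c d m_def[symmetric]
    by (simp add: mult_meet_distrib[symmetric])
qed

text \<open>The value of a function linear on the cones is additive along the edge \<open>{v, w}\<close>, so its coefficient at the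
new vertex is \<open>c v + c w\<close>.\<close>

lemma lincomb_star:
  assumes h: "\<And>v. v < N \<Longrightarrow> h v \<in> carrier G" and b: "b \<in> carrier G"
    and vw: "v < N" "w < N" "v \<noteq> w"
  shows "lincomb (Suc N) (h(v := h v \<otimes> inv b, w := h w \<otimes> inv b, N := b)) (c(N := c v + c w))
    = lincomb N h c"
proof -
  let ?h = "h(v := h v \<otimes> inv b, w := h w \<otimes> inv b, N := b)"
  let ?c = "c(N := c v + c w)"
  define A where "A = {..<N} - {v, w}"
  define R where "R = (\<Otimes>s\<in>A. h s [^] c s)"
  have A: "finite A" "v \<notin> A" "w \<notin> A" "N \<notin> A" "\<And>s. s \<in> A \<Longrightarrow> s < N" by (auto simp: A_def)
  have S: "{..<N} = insert v (insert w A)" "{..<Suc N} = insert N (insert v (insert w A))"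
    using vw by (auto simp: A_def)
  have R: "R \<in> carrier G" unfolding R_def using A h by auto
  have R': "(\<Otimes>s\<in>A. ?h s [^] ?c s) = R"
    unfolding R_def using A h by (intro finprod_cong') auto
  have 1: "lincomb N h c = h v [^] c v \<otimes> (h w [^] c w \<otimes> R)"
    unfolding lincomb_def S using A vw h by (simp add: Pi_iff R_def)
  have 2: "lincomb (Suc N) ?h ?c =
      b [^] (c v + c w) \<otimes> ((h v \<otimes> inv b) [^] c v \<otimes> ((h w \<otimes> inv b) [^] c w \<otimes> R))"
    unfolding lincomb_def S using A vw h b R' by (simp add: Pi_iff)
  have 3: "(h v \<otimes> inv b) [^] c v = h v [^] c v \<otimes> inv (b [^] c v)"
    "(h w \<otimes> inv b) [^] c w = h w [^] c w \<otimes> inv (b [^] c w)"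
    using h b vw by (simp_all add: int_pow_distrib int_pow_inv)
  have "b [^] c v \<otimes> b [^] c w \<otimes> (x \<otimes> inv (b [^] c v) \<otimes> (y \<otimes> inv (b [^] c w) \<otimes> R)) = x \<otimes> (y \<otimes> R)"
    if "x \<in> carrier G" "y \<in> carrier G" for x y
  proof -
    have "b [^] c v \<otimes> b [^] c w \<otimes> (x \<otimes> inv (b [^] c v) \<otimes> (y \<otimes> inv (b [^] c w) \<otimes> R)) =
      (b [^] c v \<otimes> inv (b [^] c v)) \<otimes> (b [^] c w \<otimes> inv (b [^] c w)) \<otimes> (x \<otimes> (y \<otimes> R))"
      using b R that by (simp only: m_ac int_pow_closed inv_closed m_closed)
    then show ?thesis using b R that by simp
  qed
  then show ?thesis unfolding 1 2 3 using h b vw by (simp add: int_pow_mult)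
qed

end

text \<open>Generators are numbered by all of \<open>nat\<close>, with value \<open>0\<close> from \<open>n\<close> on, so that words need
no bound on their variables.\<close>

locale lgroup_valuation = lgroup G for G :: "('a, 'm) lgroup_scheme" (structure) +
  fixes a :: "nat \<Rightarrow> 'a" and n :: nat
  assumes val_closed [simp]: "a i \<in> carrier G"
    and val_pos: "\<one> \<preceq> a i"
    and val_outside: "i \<ge> n \<Longrightarrow> a i = \<one>"
begin

lemma ev_closed [simp]: "ev G a t \<in> carrier G"
  by (induction t) (auto simp: join_closed meet_closed)

abbreviation hatv :: "fan \<Rightarrow> nat \<Rightarrow> 'a" where
  "hatv F v \<equiv> ev G a (hat F v)"

text \<open>What survives in an arbitrary $\ell$-group of the geometry of a fan: the hats are positive, hats that do
not span a cone have no common positive lower bound, and every generator is the combination of the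
hats prescribed by its values at the vertices. These are statements
about words, which each subdivision preserves by computation in the $\ell$-group itself.\<close>

definition adapted :: "fan \<Rightarrow> bool" where
  "adapted F \<longleftrightarrow>
     (\<forall>v<nv F. \<one> \<preceq> hatv F v) \<and>
     (\<forall>S y. S \<subseteq> {..<nv F} \<longrightarrow> S \<notin> cx F \<longrightarrow> y \<in> carrier G \<longrightarrow> \<one> \<preceq> y \<longrightarrow> (\<forall>v\<in>S. y \<preceq> hatv F v) \<longrightarrow> y = \<one>) \<and>
     (\<forall>i. a i = lincomb (nv F) (hatv F) (\<lambda>v. pt F v i))"

lemma adapted_orthant_fan: "adapted (orthant_fan n)"
proof -
  have *: "a i = lincomb n a (\<lambda>v. if i = v then 1 else 0)" for i
  proof (cases "i < n")
    case True
    have "lincomb n a (\<lambda>v. if i = v then 1 else 0) = (\<Otimes>v\<in>{..<n}. if i = v then a v else \<one>)"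
      unfolding lincomb_def by (intro finprod_cong') auto
    also have "\<dots> = a i" using True by (subst finprod_singleton) auto
    finally show ?thesis by simp
  next
    case False
    then show ?thesis using val_outside[of i] by (auto intro!: lincomb_zero[symmetric])
  qed
  show ?thesis
    unfolding adapted_def orthant_fan_def fan.sel ev.simps
    by (intro conjI) (use val_pos in simp, simp, use * in blast)
qed

lemma adapted_star:
  assumes wf: "wf_fan F" and F: "adapted F" and vw: "v \<noteq> w" and e: "{v, w} \<in> cx F"
  shows "adapted (star v w F)"
proof -
  define b where "b = hatv F v \<curlywedge> hatv F w"
  have b: "b \<in> carrier G" by (simp add: b_def meet_closed)
  have vwN: "v < nv F" "w < nv F" using wf_fan_less[OF wf e] by auto
  have pos: "\<one> \<preceq> hatv F s" if "s < nv F" for s using F that by (auto simp: adapted_def)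
  have bpos: "\<one> \<preceq> b" unfolding b_def using pos vwN by (intro meet_greatest) auto
  have hat': "hatv (star v w F) = (hatv F)(v := hatv F v \<otimes> inv b, w := hatv F w \<otimes> inv b, nv F := b)"
    by (auto simp: fun_eq_iff Let_def b_def)
  note hat'' = fun_cong[OF hat']
  have bv: "b \<preceq> hatv F v" "b \<preceq> hatv F w" by (auto simp: b_def meet_lle1 meet_lle2)
  have pos': "\<one> \<preceq> hatv (star v w F) s" if "s < Suc (nv F)" for s
    using that pos bpos bv b vwN unfolding hat'' by (auto simp: lle_diff_iff less_Suc_eq)
  have le: "hatv (star v w F) s \<preceq> hatv F s" if "s < nv F" for s
  proof -
    have "x \<otimes> inv b \<preceq> x" if "x \<in> carrier G" for x
      using mult_lle_mono[of "inv b" \<one> x] inv_lle_iff[of b \<one>] bpos b that by simp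
    then show ?thesis using that unfolding hat'' by auto
  qed
  have nonface: "y = \<one>" if S: "S \<subseteq> {..<Suc (nv F)}" "S \<notin> cx (star v w F)" and y: "y \<in> carrier G" "\<one> \<preceq> y"
    and yS: "\<And>s. s \<in> S \<Longrightarrow> y \<preceq> hatv (star v w F) s" for S y
  proof (cases "{v, w} \<subseteq> S")
    case True
    then have "y \<preceq> hatv F v \<otimes> inv b" "y \<preceq> hatv F w \<otimes> inv b"
      using yS[of v] yS[of w] vw vwN unfolding hat'' by auto
    then have "y \<preceq> \<one>"
      using diff_meet_disjoint[of "hatv F v" "hatv F w"] b y unfolding b_def[symmetric]
      by (metis meet_greatest ev_closed inv_closed m_closed)
    then show ?thesis using y by (intro lle_antisym) auto
  next
    case False
    define T where "T = S - {nv F}"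
    have TN: "T \<subseteq> {..<nv F}" using S(1) by (auto simp: T_def)
    have yT: "y \<preceq> hatv F s" if "s \<in> T" for s
      using that yS[of s] le[of s] TN y lle_trans[of y "hatv (star v w F) s" "hatv F s"]
      by (auto simp: T_def simp del: star_simps)
    have *: "y = \<one>" if "U \<subseteq> {..<nv F}" "U \<notin> cx F" "\<And>s. s \<in> U \<Longrightarrow> y \<preceq> hatv F s" for U
      using F that y unfolding adapted_def by blast
    show ?thesis
    proof (cases "nv F \<in> S")
      case True
      then have "S = insert (nv F) T" by (auto simp: T_def)
      moreover have "\<not> {v, w} \<subseteq> T" using False by (auto simp: T_def)
      ultimately have "T \<union> {v, w} \<notin> cx F" using S(2) by auto
      moreover have "y \<preceq> b" using yS[OF True] unfolding hat'' by simp
      then have "y \<preceq> hatv F v" "y \<preceq> hatv F w"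
        using bv y b lle_trans[of y b] by auto
      ultimately show ?thesis
        by (intro *[of "T \<union> {v, w}"]) (use TN vwN yT in auto)
    next
      case False
      then have "T = S" by (auto simp: T_def)
      then have "T \<notin> cx F" using S(2) \<open>\<not> {v, w} \<subseteq> S\<close> by auto
      then show ?thesis using * TN yT by auto
    qed
  qed
  have gen: "a i = lincomb (Suc (nv F)) (hatv (star v w F)) (\<lambda>s. pt (star v w F) s i)" for i
  proof -
    have "(\<lambda>s. pt (star v w F) s i) = (\<lambda>s. pt F s i)(nv F := pt F v i + pt F w i)" by auto
    then show ?thesis
      using F lincomb_star[of "nv F" "hatv F" b v w "\<lambda>s. pt F s i"] b vwN vw
      unfolding adapted_def hat' by auto
  qed
  show ?thesis unfolding adapted_def star_simps(1) using pos' nonface gen by blast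
qed

lemma refines_adapted: "\<lbrakk>refines F F'; wf_fan F; adapted F\<rbrakk> \<Longrightarrow> adapted F'"
proof (induction rule: rtranclp_induct)
  case (step F' F'')
  then show ?case using refines_wf[of F F'] by (auto elim!: star_step.cases intro: adapted_star simp del: star_simps)
qed

lemma hatv_disjoint:
  assumes "adapted F" "v < nv F" "w < nv F" "{v, w} \<notin> cx F"
  shows "hatv F v \<curlywedge> hatv F w = \<one>"
proof -
  have "{v, w} \<subseteq> {..<nv F}" "\<one> \<preceq> hatv F v \<curlywedge> hatv F w"
    using assms by (auto simp: adapted_def intro!: meet_greatest)
  moreover have "\<forall>s\<in>{v, w}. hatv F v \<curlywedge> hatv F w \<preceq> hatv F s" by (auto simp: meet_lle1 meet_lle2)
  ultimately show ?thesis using assms(1,4) unfolding adapted_def by (metis meet_closed ev_closed)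
qed

text \<open>This transfers a computation on integer points to every $\ell$-group: the coefficients are the values
of the word at the vertices. In particular a word that vanishes at all integer points of the orthant
vanishes on all positive elements of abelian $\ell$-groups.\<close>

lemma lin_ev:
  assumes F: "adapted F" and "lin F t"
  shows "ev G a t = lincomb (nv F) (hatv F) (\<lambda>v. lev (pt F v) t)"
proof -
  have h: "\<one> \<preceq> hatv F v" if "v < nv F" for v using F that by (auto simp: adapted_def)
  have disj: "hatv F v \<curlywedge> hatv F w = \<one>"
    if "no_sign_change F (gap F s t)" "v < nv F" "w < nv F" "lev (pt F v) s > lev (pt F v) t"
      "lev (pt F w) s < lev (pt F w) t" for s t v w
    using that by (intro hatv_disjoint[OF F]) (auto simp: no_sign_change_def)
  show ?thesis using assms(2)
  proof (induction t)
    case (Var i)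
    have "a i = lincomb (nv F) (hatv F) (\<lambda>v. pt F v i)" using F unfolding adapted_def by blast
    then show ?case by simp
  next
    case Zero
    then show ?case by (simp add: lincomb_zero)
  next
    case (Neg t)
    then show ?case by (simp add: lincomb_minus)
  next
    case (Add s t)
    then show ?case by (simp add: lincomb_add)
  next
    case (Join s t)
    then have "ev G a (Join s t) = lincomb (nv F) (hatv F) (\<lambda>v. lev (pt F v) s) \<curlyvee>
      lincomb (nv F) (hatv F) (\<lambda>v. lev (pt F v) t)" by simp
    also have "\<dots> = lincomb (nv F) (hatv F) (\<lambda>v. max (lev (pt F v) s) (lev (pt F v) t))"
      using Join.prems h by (intro lincomb_join_meet) (auto intro!: disj)
    finally show ?case by simp
  next
    case (Meet s t)
    then have "ev G a (Meet s t) = lincomb (nv F) (hatv F) (\<lambda>v. lev (pt F v) s) \<curlywedge>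
      lincomb (nv F) (hatv F) (\<lambda>v. lev (pt F v) t)" by simp
    also have "\<dots> = lincomb (nv F) (hatv F) (\<lambda>v. min (lev (pt F v) s) (lev (pt F v) t))"
      using Meet.prems h by (intro lincomb_join_meet) (auto intro!: disj)
    finally show ?case by simp
  qed
qed

end

subsection \<open>The real line\<close>

definition real_lgroup :: "real lgroup" where
  "real_lgroup = \<lparr>carrier = UNIV, monoid.mult = (+), one = 0, ljoin = max, lmeet = min\<rparr>"

lemma lgroup_real_lgroup: "lgroup real_lgroup"
proof -
  interpret comm_group real_lgroup
    by (rule comm_groupI) (auto simp: real_lgroup_def intro: exI[of _ "- _"])
  show ?thesis by unfold_locales (auto simp: real_lgroup_def max_def min_def)
qed

interpretation R: lgroup real_lgroup
  by (rule lgroup_real_lgroup)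

lemma real_lgroup_simps:
  "carrier real_lgroup = UNIV" "x \<otimes>\<^bsub>real_lgroup\<^esub> y = x + y" "\<one>\<^bsub>real_lgroup\<^esub> = 0"
  "x \<curlyvee>\<^bsub>real_lgroup\<^esub> y = max x y" "x \<curlywedge>\<^bsub>real_lgroup\<^esub> y = min x y"
  by (auto simp: real_lgroup_def)

lemma real_lgroup_inv: "inv\<^bsub>real_lgroup\<^esub> x = - x"
  by (rule R.inv_equality) (auto simp: real_lgroup_simps)

lemma real_lgroup_lle: "R.lle x y \<longleftrightarrow> x \<le> y"
  by (auto simp: R.lle_def real_lgroup_simps)

lemma real_lgroup_nat_pow: "x [^]\<^bsub>real_lgroup\<^esub> (k::nat) = real k * x"
  by (induction k) (auto simp: real_lgroup_simps algebra_simps)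

lemma real_lgroup_int_pow: "x [^]\<^bsub>real_lgroup\<^esub> (k::int) = of_int k * x"
  by (cases k rule: int_cases2)
    (auto simp: int_pow_int real_lgroup_nat_pow R.int_pow_neg_int real_lgroup_simps real_lgroup_inv)

lemma real_lgroup_finprod: "finprod real_lgroup f A = sum f A"
proof (induction A rule: infinite_finite_induct)
  case (insert i A)
  then show ?case by (simp add: real_lgroup_simps)
qed (auto simp: real_lgroup_simps)

lemma real_lgroup_ev: "ev real_lgroup x t = lev x t"
  by (induction t) (auto simp: real_lgroup_simps real_lgroup_inv)

definition orthant :: "nat \<Rightarrow> (nat \<Rightarrow> real) set" where
  "orthant n = {x. (\<forall>i. x i \<ge> 0) \<and> (\<forall>i\<ge>n. x i = 0)}"

lemma lgroup_valuation_real: "x \<in> orthant n \<Longrightarrow> lgroup_valuation real_lgroup x n"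
  by unfold_locales (auto simp: orthant_def real_lgroup_simps real_lgroup_lle)

lemma orthant_lev:
  assumes F: "refines (orthant_fan n) F" and x: "x \<in> orthant n"
  shows "v < nv F \<Longrightarrow> lev x (hat F v) \<ge> 0"
    and "lin F t \<Longrightarrow> lev x t = (\<Sum>v<nv F. of_int (lev (pt F v) t) * lev x (hat F v))"
proof -
  interpret V: lgroup_valuation real_lgroup x n by (rule lgroup_valuation_real[OF x])
  have ad: "V.adapted F"
    using V.refines_adapted[OF F wf_orthant_fan V.adapted_orthant_fan] .
  show "v < nv F \<Longrightarrow> lev x (hat F v) \<ge> 0"
    using ad by (auto simp: V.adapted_def real_lgroup_lle real_lgroup_ev real_lgroup_simps)
  show "lin F t \<Longrightarrow> lev x t = (\<Sum>v<nv F. of_int (lev (pt F v) t) * lev x (hat F v))"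
    using V.lin_ev[OF ad, of t]
    by (simp add: R.lincomb_def real_lgroup_ev real_lgroup_int_pow real_lgroup_finprod)
qed

lemma pt_orthant:
  assumes "refines (orthant_fan n) F"
  shows "v < nv F \<Longrightarrow> pt F v i \<ge> 0 \<and> (i \<ge> n \<longrightarrow> pt F v i = 0) \<and> (\<exists>j<n. pt F v j > 0)"
  using assms
proof (induction arbitrary: v i rule: rtranclp_induct)
  case base
  then show ?case by (auto simp: orthant_fan_def)
next
  case (step F F')
  then obtain s t where st: "F' = star s t F" "{s, t} \<in> cx F" by (auto elim!: star_step.cases)
  have wf: "wf_fan F" using step(1) refines_wf wf_orthant_fan by blast
  have "s < nv F" "t < nv F" using wf_fan_less[OF wf st(2)] by auto
  note IH = step.IH[OF this(1)] step.IH[OF this(2)] step.IH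
  show ?case
  proof (cases "v = nv F")
    case True
    obtain j where "j < n" "pt F s j > 0" using IH(1) by blast
    then have "j < n \<and> pt F s j + pt F t j > 0" using IH(2)[of j] by auto
    then show ?thesis using True st(1) IH(1)[of i] IH(2)[of i] by auto
  next
    case False
    then show ?thesis using step.prems IH(3)[of v i] st(1) by auto
  qed
qed

text \<open>The point with conic coordinates \<open>r\<close> with respect to the vertices of the fan.\<close>

definition conic :: "fan \<Rightarrow> (nat \<Rightarrow> real) \<Rightarrow> nat \<Rightarrow> real" where
  "conic F r i = (\<Sum>v<nv F. r v * of_int (pt F v i))"

text \<open>On a cone the hats are the coordinates with respect to its vertices. Undoing a subdivision, the coordinates with
respect to the coarser fan are \<open>q\<close>: the weight of the new vertex is added to both ends of the edge, and it is
recovered as the minimum of the two sums, because no cone of the finer fan contains both ends.\<close>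

lemma lev_hat_conic:
  assumes "refines (orthant_fan n) F"
    and "\<And>v. r v \<ge> 0" "{v. v < nv F \<and> r v \<noteq> 0} \<in> cx F" "v < nv F"
  shows "lev (conic F r) (hat F v) = r v"
  using assms
proof (induction arbitrary: r v rule: rtranclp_induct)
  case base
  have "conic (orthant_fan n) r v = (\<Sum>s<n. if s = v then r s else 0)"
    unfolding conic_def by (intro sum.cong) (auto simp: orthant_fan_def)
  then show ?case using base by (simp add: orthant_fan_def)
next
  case (step F F')
  then obtain a b where ab: "F' = star a b F" "a \<noteq> b" "{a, b} \<in> cx F" by (auto elim!: star_step.cases)
  have wf: "wf_fan F" using step(1) refines_wf wf_orthant_fan by blast
  have abN: "a < nv F" "b < nv F" using wf_fan_less[OF wf ab(3)] by auto
  let ?N = "nv F"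
  define q where "q = r(a := r a + r ?N, b := r b + r ?N)"
  define S where "S = {v. v < nv F' \<and> r v \<noteq> 0}"
  have S: "S \<in> cx F'" using step.prems S_def by simp
  have supp: "{v. v < ?N \<and> q v \<noteq> 0} \<in> cx F" and min0: "min (r a) (r b) = 0"
  proof -
    have ra: "r a \<ge> 0" "r b \<ge> 0" "r ?N \<ge> 0" using step.prems by auto
    consider "S \<in> cx F" "\<not> {a, b} \<subseteq> S" | T where "S = insert ?N T" "T \<union> {a, b} \<in> cx F" "\<not> {a, b} \<subseteq> T"
      using S ab(1) by auto
    then have "{v. v < ?N \<and> q v \<noteq> 0} \<in> cx F \<and> \<not> {a, b} \<subseteq> S"
    proof cases
      case 1
      have "r ?N = 0" using wf_fan_less[OF wf 1(1), of ?N] ab(1) by (auto simp: S_def)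
      then have "{v. v < ?N \<and> q v \<noteq> 0} \<subseteq> S" using ab(1) by (auto simp: S_def q_def split: if_splits)
      then show ?thesis using 1 wf_fan_down[OF wf] by blast
    next
      case 2
      have "{v. v < ?N \<and> q v \<noteq> 0} \<subseteq> T \<union> {a, b}"
      proof
        fix x assume x: "x \<in> {v. v < ?N \<and> q v \<noteq> 0}"
        show "x \<in> T \<union> {a, b}"
        proof (cases "x = a \<or> x = b")
          case False
          then have "x \<in> S" using x ab(1) by (simp add: S_def q_def)
          then show ?thesis using x 2(1) by simp
        qed auto
      qed
      from wf_fan_down[OF wf 2(2) this] show ?thesis
        using 2(1,3) abN by simp
    qed
    then show "{v. v < ?N \<and> q v \<noteq> 0} \<in> cx F" "min (r a) (r b) = 0"
      using ra abN ab(1) by (auto simp: S_def min_def)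
  qed
  have q: "\<And>v. q v \<ge> 0" using step.prems by (auto simp: q_def)
  have same: "conic F' r = conic F q"
  proof
    fix i
    define A where "A = {..<?N} - {a, b}"
    have A: "{..<?N} = insert a (insert b A)" "a \<notin> insert b A" "b \<notin> A" "finite A" "?N \<notin> A"
      using abN ab(2) by (auto simp: A_def)
    have "(\<Sum>v\<in>A. r v * of_int (pt F v i)) = (\<Sum>v\<in>A. q v * of_int (pt F v i))"
      using A by (intro sum.cong) (auto simp: q_def)
    moreover have "(\<Sum>v<?N. r v * of_int (pt F' v i)) = (\<Sum>v<?N. r v * of_int (pt F v i))"
      using ab(1) by (intro sum.cong) auto
    ultimately show "conic F' r i = conic F q i"
      unfolding conic_def using ab(1,2) A(2-) by (simp add: A(1) q_def algebra_simps)
  qed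
  have IH: "lev (conic F q) (hat F v) = q v" if "v < ?N" for v
    using step.IH[OF q supp that] .
  show ?case
    using IH[OF abN(1)] IH[OF abN(2)] IH[of v] step.prems(3) ab min0 unfolding same
    by (auto simp: Let_def q_def min_def less_Suc_eq split: if_splits)
qed

section \<open>Consequences of a relation\<close>

lemma pt_in_orthant:
  "\<lbrakk>refines (orthant_fan n) F; v < nv F\<rbrakk> \<Longrightarrow> (\<lambda>i. real_of_int (pt F v i)) \<in> orthant n"
  using pt_orthant[of n F v] by (auto simp: orthant_def)

context lgroup_valuation
begin

lemma lincomb_nat_mult:
  assumes "\<And>v. v < N \<Longrightarrow> h v \<in> carrier G"
  shows "lincomb N h (\<lambda>v. int k * c v) = lincomb N h c [^] k"
proof (induction k)
  case 0
  then show ?case using assms by (simp add: lincomb_zero)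
next
  case (Suc k)
  have "lincomb N h (\<lambda>v. int (Suc k) * c v) = lincomb N h (\<lambda>v. int k * c v + c v)"
    by (simp add: algebra_simps)
  then show ?case using assms lincomb_add[of N h "\<lambda>v. int k * c v" c] Suc by simp
qed

text \<open>If \<open>f \<ge> 0\<close> is linear on the cones, the relation \<open>f = 0\<close> becomes a vanishing sum of positive
multiples of hats. So imposing it kills exactly the hats of the vertices outside
the zero set of \<open>f\<close>.\<close>

lemma adapted_fan_of_relation:
  assumes nonneg: "\<And>x. x \<in> orthant n \<Longrightarrow> lev x f \<ge> 0" and rel: "ev G a f = \<one>"
  shows "\<exists>F. refines (orthant_fan n) F \<and> adapted F \<and> lin F f \<and> lin F t \<and>
    (\<forall>v<nv F. lev (pt F v) f \<noteq> 0 \<longrightarrow> hatv F v = \<one>)"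
proof -
  obtain F where F: "refines (orthant_fan n) F" "lin F (Add f t)"
    using exists_refinement_lin[OF wf_orthant_fan] by blast
  have ad: "adapted F" using refines_adapted[OF F(1) wf_orthant_fan adapted_orthant_fan] .
  have nn: "lev (pt F v) f \<ge> 0" if "v < nv F" for v
    using nonneg[OF pt_in_orthant[OF F(1) that]] by (simp add: lev_of_int)
  have pos: "\<one> \<preceq> hatv F v" if "v < nv F" for v using ad that by (auto simp: adapted_def)
  have one: "hatv F v = \<one>" if v: "v < nv F" and c: "lev (pt F v) f \<noteq> 0" for v
  proof (rule lle_antisym)
    let ?c = "\<lambda>v. lev (pt F v) f"
    have "hatv F v \<preceq> hatv F v [^] ?c v"
      using nat_pow_lle_exp[OF pos[OF v], of 1 "nat (?c v)"] nn[OF v] c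
      by (cases "?c v") (auto simp: int_pow_int)
    also have "hatv F v [^] ?c v \<preceq> lincomb (nv F) (hatv F) ?c"
      unfolding lincomb_def using v pos nn by (intro lle_finprod) (auto intro: int_pow_pos)
    also have "lincomb (nv F) (hatv F) ?c = \<one>"
      using lin_ev[OF ad, of f] F(2) rel by simp
    finally show "hatv F v \<preceq> \<one>" by simp
  qed (use pos v in auto)
  show ?thesis using F ad one by auto
qed

text \<open>A Nullstellensatz: after the subdivision every hat that is not killed sits at a point of the zero set,
where the coefficient of \<open>t\<close> is \<open>0\<close>.\<close>

lemma ev_eq_one_of_vanishing:
  assumes "\<And>x. x \<in> orthant n \<Longrightarrow> lev x f \<ge> 0" "ev G a f = \<one>"
    and van: "\<And>x. x \<in> orthant n \<Longrightarrow> lev x f = 0 \<Longrightarrow> lev x t = 0"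
  shows "ev G a t = \<one>"
proof -
  obtain F where F: "refines (orthant_fan n) F" "adapted F" "lin F f" "lin F t"
    and one: "\<And>v. v < nv F \<Longrightarrow> lev (pt F v) f \<noteq> 0 \<Longrightarrow> hatv F v = \<one>"
    using adapted_fan_of_relation[OF assms(1,2), of t] by blast
  have "hatv F v = \<one>" if v: "v < nv F" and "lev (pt F v) t \<noteq> 0" for v
    using van[OF pt_in_orthant[OF F(1) v]] that by (intro one) (auto simp: lev_of_int)
  then show ?thesis using lin_ev[OF F(2,4)] by (simp add: lincomb_zero)
qed

text \<open>The companion for positivity: the hats are finitely many, and at a vertex in the zero set the value of
\<open>t\<close> is a positive integer, so a common multiple exceeds the coefficients of any generator.\<close>

lemma bounded_by_multiple_of_positive:
  assumes "\<And>x. x \<in> orthant n \<Longrightarrow> lev x f \<ge> 0" "ev G a f = \<one>"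
    and pos: "\<And>x. x \<in> orthant n \<Longrightarrow> lev x f = 0 \<Longrightarrow> (\<exists>i<n. x i > 0) \<Longrightarrow> lev x t > 0"
  shows "\<exists>k::nat. a j \<preceq> ev G a t [^] k"
proof -
  obtain F where F: "refines (orthant_fan n) F" "adapted F" "lin F f" "lin F t"
    and one: "\<And>v. v < nv F \<Longrightarrow> lev (pt F v) f \<noteq> 0 \<Longrightarrow> hatv F v = \<one>"
    using adapted_fan_of_relation[OF assms(1,2), of t] by blast
  define k where "k = (\<Sum>v<nv F. nat (pt F v j))"
  have le: "hatv F v [^] pt F v j \<preceq> hatv F v [^] (int k * lev (pt F v) t)" if v: "v < nv F" for v
  proof (cases "lev (pt F v) f = 0")
    case True
    have p: "pt F v j \<ge> 0" "\<exists>i<n. pt F v i > 0" using pt_orthant[OF F(1) v] by auto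
    then have "lev (pt F v) t > 0"
      using pos[OF pt_in_orthant[OF F(1) v]] True by (simp add: lev_of_int)
    moreover have "nat (pt F v j) \<le> k" unfolding k_def using v by (intro member_le_sum) auto
    ultimately have "nat (pt F v j) \<le> k * nat (lev (pt F v) t)"
      using mult_le_mono2[of 1 "nat (lev (pt F v) t)" k] by linarith
    then have "hatv F v [^] nat (pt F v j) \<preceq> hatv F v [^] (k * nat (lev (pt F v) t))"
      using F(2) v by (intro nat_pow_lle_exp) (auto simp: adapted_def)
    moreover have "int (k * nat (lev (pt F v) t)) = int k * lev (pt F v) t"
      using \<open>lev (pt F v) t > 0\<close> by simp
    ultimately show ?thesis
      using p(1) by (metis int_pow_int nat_0_le)
  qed (use one[OF v] in simp)
  have "a j = lincomb (nv F) (hatv F) (\<lambda>v. pt F v j)" using F(2) unfolding adapted_def by blast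
  also have "\<dots> \<preceq> lincomb (nv F) (hatv F) (\<lambda>v. int k * lev (pt F v) t)"
    unfolding lincomb_def using le by (intro finprod_mono) auto
  also have "\<dots> = ev G a t [^] k"
    using lin_ev[OF F(2,4)] by (simp add: lincomb_nat_mult)
  finally show ?thesis by blast
qed

end

subsection \<open>Maps defined on generators\<close>

lemma ulhom_ev:
  assumes "lgroup G" "lgroup H" and h: "h \<in> ulhom G u H v" and a: "\<And>i. a i \<in> carrier G"
  shows "h (ev G a t) = ev H (\<lambda>i. h (a i)) t"
proof -
  interpret G: lgroup G by fact
  interpret H: lgroup H by fact
  have hom: "h \<in> hom G H" using h by (simp add: ulhom_def)
  interpret group_hom G H h by unfold_locales (rule hom)
  have cl: "ev G a t \<in> carrier G" for t using a by (induction t) (auto simp: G.join_closed G.meet_closed)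
  show ?thesis using h cl by (induction t) (auto simp: ulhom_def)
qed

lemma ulhom_comp: "\<lbrakk>h \<in> ulhom G u H v; g \<in> ulhom H v K w\<rbrakk> \<Longrightarrow> g \<circ> h \<in> ulhom G u K w"
  by (auto simp: ulhom_def hom_def Pi_iff)

text \<open>A map that sends generators to given elements is a homomorphism once it is well defined, because it
commutes with the formation of words.\<close>

lemma ulhom_of_ev:
  assumes gen: "carrier G = range (ev G a)" and cl: "\<And>t. ev H b t \<in> carrier H"
    and wd: "\<And>s t. ev G a s = ev G a t \<Longrightarrow> ev H b s = ev H b t"
  shows "\<exists>h \<in> ulhom G (a 0) H (b 0). \<forall>t. h (ev G a t) = ev H b t"
proof -
  define h where "h g = ev H b (SOME t. ev G a t = g)" for g
  have h: "h (ev G a t) = ev H b t" for t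
    unfolding h_def by (rule wd, rule someI[of _ t]) simp
  have "h \<in> ulhom G (a 0) H (b 0)"
    unfolding ulhom_def
  proof (intro CollectI conjI ballI homI)
    show "h (a 0) = b 0" using h[of "Var 0"] by simp
    fix x assume "x \<in> carrier G"
    then obtain s where s: "x = ev G a s" using gen by auto
    show "h x \<in> carrier H" using s h cl by simp
    fix y assume "y \<in> carrier G"
    then obtain t where t: "y = ev G a t" using gen by auto
    show "h (x \<otimes>\<^bsub>G\<^esub> y) = h x \<otimes>\<^bsub>H\<^esub> h y" using h[of "Add s t"] s t h by simp
    show "h (x \<curlyvee>\<^bsub>G\<^esub> y) = h x \<curlyvee>\<^bsub>H\<^esub> h y" using h[of "Join s t"] s t h by simp
    show "h (x \<curlywedge>\<^bsub>G\<^esub> y) = h x \<curlywedge>\<^bsub>H\<^esub> h y" using h[of "Meet s t"] s t h by simp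
  qed
  then show ?thesis using h by blast
qed

subsection \<open>Transport of structure\<close>

text \<open>Ideals are kernels of maps into groups on \<open>'a set\<close>, and projectivity is tested on groups over \<open>'b\<close>; groups of
real functions have to be copied to these types.\<close>

definition transport :: "('a \<Rightarrow> 'b) \<Rightarrow> 'a lgroup \<Rightarrow> 'b lgroup" where
  "transport e G = (let d = inv_into (carrier G) e in
     \<lparr>carrier = e ` carrier G, monoid.mult = \<lambda>x y. e (d x \<otimes>\<^bsub>G\<^esub> d y), one = e \<one>\<^bsub>G\<^esub>,
      ljoin = \<lambda>x y. e (d x \<curlyvee>\<^bsub>G\<^esub> d y), lmeet = \<lambda>x y. e (d x \<curlywedge>\<^bsub>G\<^esub> d y)\<rparr>)"

lemma unital_transport:
  assumes G: "unital_lgroup G u" and e: "inj_on e (carrier G)"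
  shows "unital_lgroup (transport e G) (e u)"
    and "e \<in> ulhom G u (transport e G) (e u)"
    and "inv_into (carrier G) e \<in> ulhom (transport e G) (e u) G u"
proof -
  interpret G: unital_lgroup G u by fact
  let ?T = "transport e G"
  let ?d = "inv_into (carrier G) e"
  note T = transport_def[of e G, unfolded Let_def]
  have d: "?d (e x) = x" if "x \<in> carrier G" for x using e that by simp
  have c: "carrier ?T = e ` carrier G" "\<one>\<^bsub>?T\<^esub> = e \<one>\<^bsub>G\<^esub>" by (simp_all add: T)
  have op: "e x \<otimes>\<^bsub>?T\<^esub> e y = e (x \<otimes>\<^bsub>G\<^esub> y)" "e x \<curlyvee>\<^bsub>?T\<^esub> e y = e (x \<curlyvee>\<^bsub>G\<^esub> y)"
    "e x \<curlywedge>\<^bsub>?T\<^esub> e y = e (x \<curlywedge>\<^bsub>G\<^esub> y)" if "x \<in> carrier G" "y \<in> carrier G" for x y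
    using d that by (simp_all add: T)
  have "comm_group ?T"
  proof (rule comm_groupI)
    fix x assume "x \<in> carrier ?T"
    then obtain x' where x': "x' \<in> carrier G" "x = e x'" by (auto simp: c)
    then show "\<exists>y\<in>carrier ?T. y \<otimes>\<^bsub>?T\<^esub> x = \<one>\<^bsub>?T\<^esub>"
      by (intro bexI[of _ "e (inv\<^bsub>G\<^esub> x')"]) (auto simp: c op)
  qed (auto simp: c op G.m_ac)
  then interpret T: comm_group ?T .
  have comm: "e (x \<curlyvee>\<^bsub>G\<^esub> y) = e (y \<curlyvee>\<^bsub>G\<^esub> x)" "e (x \<curlywedge>\<^bsub>G\<^esub> y) = e (y \<curlywedge>\<^bsub>G\<^esub> x)"
    if "x \<in> carrier G" "y \<in> carrier G" for x y
    using G.join_comm[OF that] G.meet_comm[OF that] by simp_all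
  have lg: "lgroup ?T"
    by unfold_locales
      (auto simp: c op G.join_closed G.meet_closed G.join_assoc G.meet_assoc
        G.join_absorb G.meet_absorb G.mult_join_distrib intro: comm)
  then interpret T: lgroup ?T .
  show e1: "e \<in> ulhom G u ?T (e u)"
    by (auto simp: ulhom_def hom_def c op)
  have pow: "e x [^]\<^bsub>?T\<^esub> (k::nat) = e (x [^]\<^bsub>G\<^esub> k)" if "x \<in> carrier G" for x k
    using that by (induction k) (auto simp: c op)
  show "unital_lgroup ?T (e u)"
  proof
    show "e u \<in> carrier ?T" using G.unit_closed by (simp add: c)
    fix g assume "g \<in> carrier ?T"
    then obtain x where x: "x \<in> carrier G" "g = e x" by (auto simp: c)
    obtain k :: nat where "k \<ge> 1" "x \<sqsubseteq>\<^bsub>lorder G\<^esub> u [^]\<^bsub>G\<^esub> k" using G.order_unit[OF x(1)] by blast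
    then have "g \<sqsubseteq>\<^bsub>lorder ?T\<^esub> e u [^]\<^bsub>?T\<^esub> k"
      using x G.unit_closed by (simp add: lorder_def pow op)
    then show "\<exists>k::nat. k \<ge> 1 \<and> g \<sqsubseteq>\<^bsub>lorder ?T\<^esub> e u [^]\<^bsub>?T\<^esub> k" using \<open>k \<ge> 1\<close> by blast
  qed
  show "?d \<in> ulhom ?T (e u) G u"
    using G.unit_closed
    by (auto simp: ulhom_def hom_def c op d G.join_closed G.meet_closed)
qed

subsection \<open>The $\ell$-group of piecewise linear functions on a set of points\<close>

text \<open>The value outside \<open>D\<close> is fixed as \<open>0\<close>, so that two words give the same function exactly if they agree on \<open>D\<close>.\<close>

definition lfun :: "(nat \<Rightarrow> real) set \<Rightarrow> lterm \<Rightarrow> (nat \<Rightarrow> real) \<Rightarrow> real" where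
  "lfun D t = (\<lambda>x. if x \<in> D then lev x t else 0)"

definition fun_lgroup :: "(nat \<Rightarrow> real) set \<Rightarrow> ((nat \<Rightarrow> real) \<Rightarrow> real) lgroup" where
  "fun_lgroup D = \<lparr>carrier = range (lfun D), monoid.mult = \<lambda>f g x. f x + g x, one = \<lambda>x. 0,
     ljoin = \<lambda>f g x. max (f x) (g x), lmeet = \<lambda>f g x. min (f x) (g x)\<rparr>"

lemma lfun_eq_iff: "lfun D s = lfun D t \<longleftrightarrow> (\<forall>x\<in>D. lev x s = lev x t)"
  by (auto simp: lfun_def fun_eq_iff)

lemma lfun_simps:
  "(\<lambda>x. lfun D s x + lfun D t x) = lfun D (Add s t)"
  "(\<lambda>x. max (lfun D s x) (lfun D t x)) = lfun D (Join s t)"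
  "(\<lambda>x. min (lfun D s x) (lfun D t x)) = lfun D (Meet s t)"
  "(\<lambda>x. 0) = lfun D Zero"
  by (auto simp: lfun_def fun_eq_iff)

lemma fun_lgroup_simps:
  "carrier (fun_lgroup D) = range (lfun D)" "\<one>\<^bsub>fun_lgroup D\<^esub> = lfun D Zero"
  "lfun D s \<otimes>\<^bsub>fun_lgroup D\<^esub> lfun D t = lfun D (Add s t)"
  "lfun D s \<curlyvee>\<^bsub>fun_lgroup D\<^esub> lfun D t = lfun D (Join s t)"
  "lfun D s \<curlywedge>\<^bsub>fun_lgroup D\<^esub> lfun D t = lfun D (Meet s t)"
  by (simp_all add: fun_lgroup_def lfun_simps)

lemma lgroup_fun_lgroup: "lgroup (fun_lgroup D)"
proof -
  have "comm_group (fun_lgroup D)"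
  proof (rule comm_groupI)
    fix f assume "f \<in> carrier (fun_lgroup D)"
    then obtain t where "f = lfun D t" by (auto simp: fun_lgroup_simps)
    then have "lfun D (Neg t) \<otimes>\<^bsub>fun_lgroup D\<^esub> f = \<one>\<^bsub>fun_lgroup D\<^esub>"
      by (simp add: fun_lgroup_simps lfun_eq_iff)
    then show "\<exists>g\<in>carrier (fun_lgroup D). g \<otimes>\<^bsub>fun_lgroup D\<^esub> f = \<one>\<^bsub>fun_lgroup D\<^esub>"
      by (auto simp: fun_lgroup_simps(1))
  qed (auto simp: fun_lgroup_simps lfun_eq_iff intro!: rangeI)
  then interpret comm_group "fun_lgroup D" .
  show ?thesis
    by unfold_locales (auto simp: fun_lgroup_simps lfun_eq_iff intro!: rangeI)
qed

lemma ev_fun_lgroup: "ev (fun_lgroup D) (\<lambda>i. lfun D (Var i)) t = lfun D t"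
proof -
  interpret lgroup "fun_lgroup D" by (rule lgroup_fun_lgroup)
  have inv: "inv\<^bsub>fun_lgroup D\<^esub> (lfun D t) = lfun D (Neg t)" for t
    by (rule inv_equality) (auto simp: fun_lgroup_simps lfun_eq_iff)
  show ?thesis by (induction t) (auto simp: fun_lgroup_simps inv)
qed

lemma lev_bounded:
  fixes M :: real
  assumes "\<And>x i. x \<in> D \<Longrightarrow> \<bar>x i\<bar> \<le> M"
  shows "\<exists>B. \<forall>x\<in>D. \<bar>lev x t\<bar> \<le> B"
proof (induction t)
  case (Add s t)
  then obtain A B where "\<forall>x\<in>D. \<bar>lev x s\<bar> \<le> A" "\<forall>x\<in>D. \<bar>lev x t\<bar> \<le> B" by blast
  then show ?case by (intro exI[of _ "A + B"]) (force intro: order_trans[OF abs_triangle_ineq])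
next
  case (Join s t)
  then obtain A B where "\<forall>x\<in>D. \<bar>lev x s\<bar> \<le> A" "\<forall>x\<in>D. \<bar>lev x t\<bar> \<le> B" by blast
  then show ?case by (intro exI[of _ "max A B"]) (force simp: max_def)
next
  case (Meet s t)
  then obtain A B where "\<forall>x\<in>D. \<bar>lev x s\<bar> \<le> A" "\<forall>x\<in>D. \<bar>lev x t\<bar> \<le> B" by blast
  then show ?case by (intro exI[of _ "max A B"]) (force simp: max_def min_def)
qed (use assms in auto)

lemma unital_fun_lgroup:
  fixes M :: real
  assumes D: "\<And>x i. x \<in> D \<Longrightarrow> \<bar>x i\<bar> \<le> M" "\<And>x. x \<in> D \<Longrightarrow> x 0 = 1"
  shows "unital_lgroup (fun_lgroup D) (lfun D (Var 0))"
proof -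
  interpret lgroup "fun_lgroup D" by (rule lgroup_fun_lgroup)
  show ?thesis
  proof
    show "lfun D (Var 0) \<in> carrier (fun_lgroup D)" by (simp add: fun_lgroup_simps)
    fix g assume "g \<in> carrier (fun_lgroup D)"
    then obtain t where t: "g = lfun D t" by (auto simp: fun_lgroup_simps)
    obtain B where B: "\<And>x. x \<in> D \<Longrightarrow> \<bar>lev x t\<bar> \<le> B" using lev_bounded[of D M t] D(1) by blast
    have "\<exists>s. lfun D (Var 0) [^]\<^bsub>fun_lgroup D\<^esub> k = lfun D s \<and> (\<forall>x\<in>D. lev x s = real k)" for k :: nat
    proof (induction k)
      case 0
      then show ?case by (auto simp: fun_lgroup_simps intro!: exI[of _ Zero])
    next
      case (Suc k)
      then obtain s where "lfun D (Var 0) [^]\<^bsub>fun_lgroup D\<^esub> k = lfun D s" "\<forall>x\<in>D. lev x s = real k" by blast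
      then show ?case using D(2) by (intro exI[of _ "Add s (Var 0)"]) (auto simp: fun_lgroup_simps)
    qed
    then obtain s where s: "lfun D (Var 0) [^]\<^bsub>fun_lgroup D\<^esub> Suc (nat \<lceil>B\<rceil>) = lfun D s"
      "\<forall>x\<in>D. lev x s = real (Suc (nat \<lceil>B\<rceil>))" by blast
    have "lev x t \<le> lev x s" if "x \<in> D" for x
      using B[OF that] s(2) that real_nat_ceiling_ge[of B] abs_le_D1[of "lev x t" B] 
      by (simp del: of_nat_nat of_nat_Suc) linarith
    then have "g \<sqsubseteq>\<^bsub>lorder (fun_lgroup D)\<^esub> lfun D (Var 0) [^]\<^bsub>fun_lgroup D\<^esub> Suc (nat \<lceil>B\<rceil>)"
      unfolding t s(1) by (auto simp: lorder_def fun_lgroup_simps lfun_eq_iff min_def)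
    then show "\<exists>k::nat. k \<ge> 1 \<and> g \<sqsubseteq>\<^bsub>lorder (fun_lgroup D)\<^esub> lfun D (Var 0) [^]\<^bsub>fun_lgroup D\<^esub> k"
      by (intro exI[of _ "Suc (nat \<lceil>B\<rceil>)"]) auto
  qed
qed

section \<open>Projective unital $\ell$-groups are finitely presented\<close>

definition tpos :: "lterm \<Rightarrow> lterm" where "tpos t = Join t Zero"

definition tabs :: "lterm \<Rightarrow> lterm" where "tabs t = Join t (Neg t)"

primrec tmul :: "nat \<Rightarrow> lterm \<Rightarrow> lterm" where
  "tmul 0 t = Zero"
| "tmul (Suc k) t = Add (tmul k t) t"

primrec tsum :: "(nat \<Rightarrow> lterm) \<Rightarrow> nat \<Rightarrow> lterm" where
  "tsum g 0 = Zero"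
| "tsum g (Suc k) = Add (tsum g k) (g k)"

lemma lev_tpos [simp]: "lev x (tpos t) = max (lev x t) 0"
  by (simp add: tpos_def)

lemma lev_tabs [simp]: "lev x (tabs t) = \<bar>lev x t\<bar>"
  by (simp add: tabs_def max_def abs_if)

lemma lev_tmul [simp]: "lev x (tmul k t) = of_nat k * lev x t"
  by (induction k) (auto simp: algebra_simps)

lemma lev_tsum [simp]: "lev x (tsum g k) = (\<Sum>i<k. lev x (g i))"
  by (induction k) auto

text \<open>A presentation of \<open>(G, a 0)\<close> by one relation \<open>f = 0\<close>: the zero set of \<open>f\<close> in the orthant is a cone over
the compact slice where the coordinate of the unit is \<open>1\<close>, and each point of the slice defines a homomorphism to the reals
that sends the generators to the coordinates of the point.\<close>

locale rational_presentation = lgroup_valuation G a n + unital_lgroup G "a 0"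
  for G :: "('a, 'm) lgroup_scheme" (structure) and a :: "nat \<Rightarrow> 'a" and n :: nat +
  fixes f :: lterm and N :: nat
  assumes gen: "carrier G = range (ev G a)"
    and rel_nonneg: "x \<in> orthant n \<Longrightarrow> (lev x f :: real) \<ge> 0"
    and rel_one: "ev G a f = \<one>"
    and rel_bounded: "\<lbrakk>x \<in> orthant n; lev x f = 0\<rbrakk> \<Longrightarrow> x i \<le> real N * x 0"
    and rel_eval: "\<lbrakk>x \<in> orthant n; lev x f = 0; x 0 = 1; ev G a s = ev G a t\<rbrakk> \<Longrightarrow> lev x s = lev x t"

context lgroup_valuation
begin

lemma ev_tabs: "ev G a t = \<one> \<Longrightarrow> ev G a (tabs t) = \<one>"
  using join_absorb[of \<one> \<one>] by (simp add: tabs_def meet_idem)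

lemma ev_tpos: "ev G a t \<preceq> \<one> \<Longrightarrow> ev G a (tpos t) = \<one>"
  by (simp add: tpos_def lle_join_iff)

lemma ev_tmul: "ev G a (tmul k t) = ev G a t [^] k"
  by (induction k) auto

lemma ev_tsum: "(\<And>i. i < k \<Longrightarrow> ev G a (g i) = \<one>) \<Longrightarrow> ev G a (tsum g k) = \<one>"
  by (induction k) auto

end

context unital_lgroup
begin

text \<open>Write \<open>u = p - q\<close> with \<open>p \<and> q = 0\<close>. A positive multiple \<open>k u\<close> being positive gives
  \<open>q \<le> k q \<le> k p\<close>, while \<open>q\<close> is disjoint from \<open>k p\<close>; so \<open>q = 0\<close>.\<close>

lemma unit_pos: "\<one> \<preceq> u"
proof -
  obtain k :: nat where "inv u \<preceq> u [^] k"
    using order_unit[of "inv u"] unit_closed by (auto simp: lorder_iff)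
  then have "u \<otimes> inv u \<preceq> u \<otimes> u [^] k" using unit_closed by (intro mult_lle_mono) auto
  then have k: "\<one> \<preceq> u [^] Suc k" using unit_closed by (simp add: m_comm)
  define q where "q = inv (u \<curlywedge> \<one>)"
  define p where "p = u \<otimes> q"
  have cl: "q \<in> carrier G" "p \<in> carrier G" using unit_closed by (auto simp: q_def p_def meet_closed)
  have disj: "p \<curlywedge> q = \<one>"
    using diff_meet_disjoint[of u \<one>] unit_closed cl by (simp add: p_def q_def)
  have q1: "\<one> \<preceq> q" using meet_lle2[of p q] cl disj by simp
  have "q [^] Suc k \<preceq> q [^] Suc k \<otimes> u [^] Suc k"
    using k cl unit_closed by (intro lle_mult_pos) auto
  also have "q [^] Suc k \<otimes> u [^] Suc k = p [^] Suc k"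
    using nat_pow_distrib[OF cl(1) unit_closed, of "Suc k"] cl(1) unit_closed
    by (simp only: p_def m_comm[of u q])
  finally have "q [^] Suc k \<preceq> p [^] Suc k" using cl unit_closed by simp
  moreover have "q \<preceq> q [^] Suc k" using nat_pow_lle_exp[OF q1 cl(1), of 1 "Suc k"] cl by simp
  ultimately have "q \<preceq> p [^] Suc k" using cl lle_trans[of q "q [^] Suc k" "p [^] Suc k"] by simp
  moreover have "q \<curlywedge> p [^] Suc k = \<one>"
    using disj cl by (intro disjoint_pow disjoint_comm[of p q]) auto
  ultimately have "q = \<one>" by (simp add: lle_def)
  then have "u \<curlywedge> \<one> = \<one>" using cl unit_closed unfolding q_def by (metis inv_inv inv_one meet_closed one_closed)
  then show ?thesis using unit_closed by (simp add: lle_def meet_comm)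
qed

lemma finitely_generated_valuation:
  assumes "finitely_generated G"
  obtains a n where "lgroup_valuation G a n" "a 0 = u" "carrier G = range (ev G a)"
proof -
  obtain S where S: "finite S" "S \<subseteq> carrier G" "lgenerate G S = carrier G"
    using assms by (auto simp: finitely_generated_def)
  obtain l where l: "set l = S" using finite_list[OF S(1)] by blast
  define L where "L = u # map (\<lambda>x. x \<curlyvee> \<one>) l @ map (\<lambda>x. inv x \<curlyvee> \<one>) l"
  define a where "a i = (if i < length L then L ! i else \<one>)" for i
  have L: "x \<in> carrier G \<and> \<one> \<preceq> x" if "x \<in> set L" for x
    using that S(2) l unit_pos unit_closed by (auto simp: L_def join_closed join_lge2)
  have val: "lgroup_valuation G a (length L)"
    by unfold_locales (use L in \<open>auto simp: a_def\<close>)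
  interpret lgroup_valuation G a "length L" by (rule val)
  have La: "\<exists>i. a i = x" if "x \<in> set L" for x
    using that by (metis a_def in_set_conv_nth)
  have "\<exists>t. ev G a t = x" if "x \<in> lgenerate G S" for x
    using that
  proof induction
    case one
    show ?case by (rule exI[of _ Zero]) simp
  next
    case (incl x)
    then have x: "x \<in> carrier G" using S by auto
    obtain i j where ij: "a i = x \<curlyvee> \<one>" "a j = inv x \<curlyvee> \<one>"
      using incl l La[of "x \<curlyvee> \<one>"] La[of "inv x \<curlyvee> \<one>"] by (auto simp: L_def)
    have "a i = x \<otimes> a j" using x by (simp add: ij mult_join_distrib join_comm)
    then have "ev G a (Add (Var i) (Neg (Var j))) = x" using x by (simp add: m_assoc)
    then show ?case by blast
  next
    case (inv x)
    then show ?case by (metis ev.simps(3))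
  next
    case (mult x y)
    then show ?case by (metis ev.simps(4))
  next
    case (join x y)
    then show ?case by (metis ev.simps(5))
  next
    case (meet x y)
    then show ?case by (metis ev.simps(6))
  qed
  then have "carrier G = range (ev G a)" using S(3) by auto
  then show ?thesis using that val by (simp add: a_def L_def)
qed

end

lemma countable_inj_on_infinite:
  assumes "countable C" "infinite (UNIV :: 'b set)"
  shows "\<exists>e :: 'c \<Rightarrow> 'b. inj_on e C"
proof -
  obtain g :: "nat \<Rightarrow> 'b" where "inj g" using infinite_countable_subset[OF assms(2)] by blast
  then have "inj_on (g \<circ> to_nat_on C) C"
    using inj_on_to_nat_on[OF assms(1)] by (intro comp_inj_on) (auto intro: inj_on_subset)
  then show ?thesis by blast
qed

text \<open>Countability makes copies of \<open>A\<close> and \<open>G\<close> over the infinite type \<open>'b\<close>, where the identity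
of the copy of \<open>G\<close> can be lifted.\<close>

lemma projective_retraction:
  fixes G :: "'a lgroup" and A :: "'c lgroup"
  assumes G: "unital_lgroup G u" and A: "unital_lgroup A v"
    and c: "countable (carrier G)" "countable (carrier A)"
    and inf: "infinite (UNIV :: 'b set)" and proj: "projective TYPE('b) G u"
    and \<psi>: "\<psi> \<in> ulhom A v G u" "\<psi> ` carrier A = carrier G"
  obtains \<theta> where "\<theta> \<in> ulhom G u A v" "\<And>x. x \<in> carrier G \<Longrightarrow> \<psi> (\<theta> x) = x"
proof -
  obtain e1 :: "'a \<Rightarrow> 'b" where e1: "inj_on e1 (carrier G)"
    using countable_inj_on_infinite[OF c(1) inf] by blast
  obtain e2 :: "'c \<Rightarrow> 'b" where e2: "inj_on e2 (carrier A)"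
    using countable_inj_on_infinite[OF c(2) inf] by blast
  define d where "d = inv_into (carrier A) e2"
  note TG = unital_transport[OF G e1] and TA = unital_transport[OF A e2, folded d_def]
  have h: "e1 \<circ> \<psi> \<circ> d \<in> ulhom (transport e2 A) (e2 v) (transport e1 G) (e1 u)"
    by (rule ulhom_comp[OF TA(3) ulhom_comp[OF \<psi>(1) TG(2)]])
  have "d ` carrier (transport e2 A) = carrier A"
    using e2 by (auto simp: transport_def Let_def d_def image_image)
  moreover have "(e1 \<circ> \<psi> \<circ> d) ` carrier (transport e2 A) = e1 ` (\<psi> ` (d ` carrier (transport e2 A)))"
    by (simp add: image_image)
  ultimately have s: "(e1 \<circ> \<psi> \<circ> d) ` carrier (transport e2 A) = carrier (transport e1 G)"
    using \<psi>(2) by (simp add: transport_def Let_def)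
  obtain \<theta> where \<theta>: "\<theta> \<in> ulhom G u (transport e2 A) (e2 v)"
    "\<forall>x\<in>carrier G. e1 x = (e1 \<circ> \<psi> \<circ> d) (\<theta> x)"
    using proj[unfolded projective_def, rule_format, OF TA(1) TG(1) h s TG(2)] by blast
  have d\<theta>: "d \<circ> \<theta> \<in> ulhom G u A v" by (rule ulhom_comp[OF \<theta>(1) TA(3)])
  have "\<psi> ((d \<circ> \<theta>) x) = x" if "x \<in> carrier G" for x
  proof -
    have "(d \<circ> \<theta>) x \<in> carrier A" using d\<theta> that by (auto simp: ulhom_def hom_def)
    then have "\<psi> ((d \<circ> \<theta>) x) \<in> carrier G" using \<psi>(2) by blast
    moreover have "e1 (\<psi> ((d \<circ> \<theta>) x)) = e1 x" using \<theta>(2) that by simp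
    ultimately show ?thesis using e1 that by (meson inj_onD)
  qed
  then show ?thesis using that d\<theta> by blast
qed

text \<open>The cone over the slice at height \<open>x 0 = 1\<close>: apart from its apex every point can be
scaled into the slice.\<close>

lemma orthant_cases:
  assumes x: "x \<in> orthant n" and b: "\<And>i. x i \<le> real N * x 0"
  obtains "x = (\<lambda>i. 0)" | y where "y \<in> orthant n" "y 0 = 1" "\<And>i. y i \<le> N" "x 0 > 0"
    "x = (\<lambda>i. x 0 * y i)"
proof (cases "x 0 = 0")
  case True
  have "x i = 0" for i
    using x b[of i] True by (simp add: orthant_def antisym)
  then have "x = (\<lambda>i. 0)" by blast
  then show ?thesis using that(1) by blast
next
  case False
  then have p: "x 0 > 0" using x by (auto simp: orthant_def less_le)
  show ?thesis
    by (rule that(2)[of "\<lambda>i. x i / x 0"])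
      (use x p b in \<open>auto simp: orthant_def field_simps\<close>)
qed

text \<open>Take positive generators \<open>a 0 = u, a 1, \<dots>\<close> with \<open>a i \<le> N u\<close>. These bounds are the relation \<open>f1 = 0\<close>, and
\<open>D\<close> is the slice of its zero set. The functions on \<open>D\<close> map onto \<open>G\<close>, by the Nullstellensatz for \<open>f1\<close>.
Projectivity splits this map by some \<open>\<theta>\<close>; let the word \<open>\<tau> i\<close> represent \<open>\<theta> (a i)\<close>. At a point \<open>x\<close> of \<open>D\<close> that is
fixed by the tuple \<open>\<tau>\<close>, the composition of \<open>\<theta>\<close> with the evaluation at \<open>x\<close> is a
homomorphism with the values \<open>x i\<close>. So the relation is \<open>f1\<close> plus the distances between \<open>\<tau> i\<close> and the coordinates.\<close>

lemma projective_imp_presentation: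
  fixes G :: "'a lgroup"
  assumes G: "unital_lgroup G u" and fg: "finitely_generated G"
    and inf: "infinite (UNIV :: 'b set)" and proj: "projective TYPE('b) G u"
  obtains a n f N where "rational_presentation G a n f N" "a 0 = u"
proof -
  interpret unital_lgroup G u by fact
  obtain a n where val: "lgroup_valuation G a n" and a0: "a 0 = u" and gen: "carrier G = range (ev G a)"
    using finitely_generated_valuation[OF fg] by metis
  interpret lgroup_valuation G a n by fact
  have "\<exists>k::nat. a i \<preceq> u [^]\<^bsub>G\<^esub> k" for i using order_unit[of "a i"] by (auto simp: lorder_iff)
  then obtain k :: "nat \<Rightarrow> nat" where k: "\<And>i. a i \<preceq> u [^]\<^bsub>G\<^esub> k i" by metis
  define N where "N = (\<Sum>i<n. k i)"
  have N: "a i \<preceq> u [^]\<^bsub>G\<^esub> N" if "i < n" for i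
  proof -
    have "k i \<le> N" unfolding N_def using that member_le_sum[of i "{..<n}" k] by simp
    then have "u [^]\<^bsub>G\<^esub> k i \<preceq> u [^]\<^bsub>G\<^esub> N" using unit_pos unit_closed by (intro nat_pow_lle_exp)
    then show ?thesis using k[of i] unit_closed lle_trans[of "a i" "u [^]\<^bsub>G\<^esub> k i" "u [^]\<^bsub>G\<^esub> N"] by simp
  qed
  define f1 where "f1 = tsum (\<lambda>i. tpos (Add (Var i) (Neg (tmul N (Var 0))))) n"
  have f1_one: "ev G a f1 = \<one>\<^bsub>G\<^esub>"
    unfolding f1_def
  proof (intro ev_tsum ev_tpos)
    fix i assume "i < n"
    then have "a i \<otimes>\<^bsub>G\<^esub> inv\<^bsub>G\<^esub> (u [^]\<^bsub>G\<^esub> N) \<preceq> u [^]\<^bsub>G\<^esub> N \<otimes>\<^bsub>G\<^esub> inv\<^bsub>G\<^esub> (u [^]\<^bsub>G\<^esub> N)"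
      using N unit_closed by (intro mult_lle_mono2) auto
    then show "ev G a (Add (Var i) (Neg (tmul N (Var 0)))) \<preceq> \<one>\<^bsub>G\<^esub>"
      using unit_closed a0 by (simp add: ev_tmul)
  qed
  have f1_nn: "lev x f1 \<ge> 0" for x :: "nat \<Rightarrow> real"
    by (auto simp: f1_def intro!: sum_nonneg)
  have f1_bd: "x i \<le> real N * x 0" if x: "x \<in> orthant n" "lev x f1 = 0" for x i
  proof (cases "i < n")
    case True
    have "(\<Sum>i<n. max (x i - real N * x 0) 0) = 0" using x(2) by (simp add: f1_def)
    then have "max (x i - real N * x 0) 0 = 0"
      using True by (subst (asm) sum_nonneg_eq_0_iff) auto
    then show ?thesis by (simp add: max_def split: if_splits)
  next
    case False
    then show ?thesis using x by (auto simp: orthant_def)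
  qed
  define D where "D = {x \<in> orthant n. x 0 = 1 \<and> (\<forall>i. x i \<le> real N)}"
  have wd: "ev G a s = ev G a t" if "lfun D s = lfun D t" for s t
  proof -
    have "ev G a (Add s (Neg t)) = \<one>\<^bsub>G\<^esub>"
    proof (rule ev_eq_one_of_vanishing[OF f1_nn f1_one])
      fix x assume x: "x \<in> orthant n" "lev x f1 = 0"
      from x(1) f1_bd[OF x] show "lev x (Add s (Neg t)) = 0"
      proof (cases rule: orthant_cases)
        case 1
        then show ?thesis using lev_scale[of 0 x s] lev_scale[of 0 x t] by simp
      next
        case (2 y)
        have "lev y s = lev y t" using 2(1-3) that by (auto simp: lfun_eq_iff D_def)
        moreover have "lev x r = x 0 * lev y r" for r
          using lev_scale[of "x 0" y r] 2(4,5) by (metis less_imp_le)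
        ultimately show ?thesis by (simp only: lev.simps)
      qed
    qed
    then show ?thesis by (metis ev.simps(3,4) ev_closed inv_closed inv_equality inv_inv)
  qed
  let ?A = "fun_lgroup D"
  let ?b = "\<lambda>i. lfun D (Var i)"
  have A: "unital_lgroup ?A (lfun D (Var 0))"
    by (rule unital_fun_lgroup[of D "real N"]) (auto simp: D_def orthant_def)
  have genA: "carrier ?A = range (ev ?A ?b)"
    by (simp add: ev_fun_lgroup fun_lgroup_simps(1))
  obtain \<psi> where \<psi>: "\<psi> \<in> ulhom ?A (?b 0) G (a 0)" "\<And>t. \<psi> (ev ?A ?b t) = ev G a t"
    using ulhom_of_ev[OF genA ev_closed wd, unfolded ev_fun_lgroup] unfolding ev_fun_lgroup by blast
  have \<psi>_surj: "\<psi> ` carrier ?A = carrier G"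
    unfolding genA gen by (simp add: image_image \<psi>(2))
  have cnt: "countable (carrier G)" "countable (carrier ?A)"
    unfolding gen genA by simp_all
  obtain \<theta> where \<theta>: "\<theta> \<in> ulhom G u ?A (?b 0)" "\<And>x. x \<in> carrier G \<Longrightarrow> \<psi> (\<theta> x) = x"
    using projective_retraction[OF G A cnt inf proj] \<psi>(1) \<psi>_surj unfolding a0 by metis
  have \<theta>_cl: "\<theta> x \<in> range (lfun D)" if "x \<in> carrier G" for x
    using \<theta>(1) that by (auto simp: ulhom_def hom_def fun_lgroup_simps(1))
  then have "\<exists>t. \<theta> (a i) = lfun D t" for i by (metis val_closed rangeE)
  then obtain \<tau> where \<tau>: "\<And>i. \<theta> (a i) = lfun D (\<tau> i)" by metis
  have \<tau>_ev: "ev G a (\<tau> i) = a i" for i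
    using \<theta>(2)[of "a i"] \<psi>(2)[of "\<tau> i"] by (simp add: \<tau> ev_fun_lgroup)
  define f where "f = Add f1 (tsum (\<lambda>i. tabs (Add (\<tau> i) (Neg (Var i)))) n)"
  have f2_nn: "(\<Sum>i<n. \<bar>lev x (\<tau> i) - x i\<bar>) \<ge> 0" for x :: "nat \<Rightarrow> real" by (auto intro!: sum_nonneg)
  have f_nn: "lev x f \<ge> 0" for x :: "nat \<Rightarrow> real"
    using f1_nn[of x] f2_nn[of x] by (simp add: f_def)
  have f_zero: "lev x f1 = 0" "i < n \<Longrightarrow> lev x (\<tau> i) = x i" if "lev x f = 0" for x :: "nat \<Rightarrow> real" and i
  proof -
    have "lev x f1 + (\<Sum>i<n. \<bar>lev x (\<tau> i) - x i\<bar>) = 0" using that by (simp add: f_def)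
    then have *: "lev x f1 = 0" "(\<Sum>i<n. \<bar>lev x (\<tau> i) - x i\<bar>) = 0"
      using f1_nn[of x] f2_nn[of x] by linarith+
    then show "lev x f1 = 0" by simp
    show "lev x (\<tau> i) = x i" if "i < n" using *(2) that by (subst (asm) sum_nonneg_eq_0_iff) auto
  qed
  have f_one: "ev G a f = \<one>\<^bsub>G\<^esub>"
    using f1_one \<tau>_ev by (auto simp: f_def intro!: ev_tsum ev_tabs)
  have f_eval: "lev x s = lev x t"
    if x: "x \<in> orthant n" "lev x f = 0" "x 0 = 1" and st: "ev G a s = ev G a t" for x s t
  proof -
    have xD: "x \<in> D" using x f1_bd[OF x(1) f_zero(1)[OF x(2)]] by (simp add: D_def)
    have "\<theta> (ev G a r) x = lev x r" for r
    proof -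
      have "\<theta> (ev G a r) = ev ?A (\<lambda>i. \<theta> (a i)) r"
        by (rule ulhom_ev[OF lgroup_axioms lgroup_fun_lgroup \<theta>(1)]) simp
      moreover have "\<exists>q. ev ?A (\<lambda>i. \<theta> (a i)) r = lfun D q \<and> lev x q = lev x r"
      proof (induction r)
        case (Var i)
        show ?case
        proof (cases "i < n")
          case True
          then show ?thesis using f_zero(2)[OF x(2)] \<tau> by auto
        next
          case False
          have "\<theta> \<one>\<^bsub>G\<^esub> = lfun D Zero"
            using ulhom_ev[OF lgroup_axioms lgroup_fun_lgroup \<theta>(1), of a Zero]
            by (simp add: fun_lgroup_simps)
          then show ?thesis
            using False val_outside[of i] x(1) by (auto simp: orthant_def intro!: exI[of _ Zero])
        qed
      next
        case (Neg r)
        then obtain q where q: "ev ?A (\<lambda>i. \<theta> (a i)) r = lfun D q" "lev x q = lev x r" by blast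
        interpret A: lgroup ?A by (rule lgroup_fun_lgroup)
        have "inv\<^bsub>?A\<^esub> (lfun D q) = lfun D (Neg q)"
          by (rule A.inv_equality) (auto simp: fun_lgroup_simps lfun_eq_iff)
        then show ?case using q by (auto intro!: exI[of _ "Neg q"])
      qed (auto simp: fun_lgroup_simps; metis lev.simps fun_lgroup_simps)+
      ultimately show ?thesis using xD by (auto simp: lfun_def)
    qed
    then show ?thesis using st by metis
  qed
  interpret A0: unital_lgroup G "a 0" unfolding a0 by fact
  have "rational_presentation G a n f N"
    by unfold_locales (use gen f_nn f_one f_zero f1_bd f_eval in blast)+
  then show ?thesis using that a0 by blast
qed

section \<open>Maximal ideals are points\<close>

text \<open>The image of \<open>h\<close> is copied to \<open>'a set\<close> along its fibres.\<close>

lemma lideal_kernel: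
  fixes G :: "('a, 'm) lgroup_scheme" and K :: "'c lgroup"
  assumes K: "unital_lgroup K v" and h: "h \<in> ulhom G u K v" and surj: "h ` carrier G = carrier K"
  shows "lideal G u (kernel G K h)"
proof -
  define e where "e y = {g \<in> carrier G. h g = y}" for y
  have "inj_on e (carrier K)"
  proof (rule inj_onI)
    fix y z assume "y \<in> carrier K" "e y = e z"
    then obtain g where "g \<in> carrier G" "h g = y" using surj by (metis imageE)
    then have "g \<in> e y" by (simp add: e_def)
    then have "g \<in> e z" using \<open>e y = e z\<close> by simp
    then show "y = z" using \<open>h g = y\<close> by (simp add: e_def)
  qed
  note inj = this and T = unital_transport[OF K this]
  interpret K: unital_lgroup K v by fact
  have "kernel G (transport e K) (e \<circ> h) = kernel G K h"
  proof -
    have "e (h g) = e \<one>\<^bsub>K\<^esub> \<longleftrightarrow> h g = \<one>\<^bsub>K\<^esub>" if "g \<in> carrier G" for g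
      using inj surj that by (intro inj_on_eq_iff[OF inj]) auto
    then show ?thesis by (auto simp: kernel_def transport_def Let_def)
  qed
  then show ?thesis
    unfolding lideal_def using T(1) ulhom_comp[OF h T(2)] by metis
qed

lemma continuous_map_lev:
  "continuous_map (powertop_real UNIV) euclideanreal (\<lambda>x. lev x t)"
  by (induction t) (auto intro!: continuous_intros)

context rational_presentation
begin

text \<open>All closure properties of ideals are used in this form: membership of words is computed in the codomain.\<close>

lemma lideal_ev:
  assumes "lideal G (a 0) J"
  obtains H :: "'a set lgroup" and b where "lgroup H" "\<And>i. b i \<in> carrier H"
    "\<And>t. ev G a t \<in> J \<longleftrightarrow> ev H b t = \<one>\<^bsub>H\<^esub>" "J \<subseteq> carrier G"
proof -
  obtain H :: "'a set lgroup" and v h where H: "unital_lgroup H v" and h: "h \<in> ulhom G (a 0) H v"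
    and J: "J = kernel G H h" using assms by (auto simp: lideal_def)
  interpret H: unital_lgroup H v by fact
  have "h (ev G a t) = ev H (\<lambda>i. h (a i)) t" for t
    by (rule ulhom_ev[OF lgroup_axioms H.lgroup_axioms h]) simp
  moreover have "h (a i) \<in> carrier H" for i using h by (auto simp: ulhom_def hom_def)
  ultimately show ?thesis
    using that[OF H.lgroup_axioms, of "\<lambda>i. h (a i)"] J by (auto simp: kernel_def)
qed

text \<open>In the codomain the image of the unit is \<open>\<le> 0\<close>, hence so are all its multiples, and with them
the image of every element and of its negative.\<close>

lemma lideal_eq_carrier:
  assumes J: "lideal G (a 0) J" and t: "ev G a t \<in> J" and le: "a 0 \<preceq> ev G a t [^] (k::nat)"
  shows "J = carrier G"
proof -
  obtain H :: "'a set lgroup" and b where H: "lgroup H" and b: "\<And>i. b i \<in> carrier H"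
    and JH: "\<And>t. ev G a t \<in> J \<longleftrightarrow> ev H b t = \<one>\<^bsub>H\<^esub>" and JG: "J \<subseteq> carrier G"
    using lideal_ev[OF J] by metis
  interpret H: lgroup H by fact
  have cl: "ev H b t \<in> carrier H" for t
    using b by (induction t) (auto simp: H.join_closed H.meet_closed)
  \<comment> \<open>The difference of \<open>s\<close> and \<open>s \<and> t\<close> has value \<open>0\<close>, so it belongs to \<open>J\<close>.\<close>
  have mono: "H.lle (ev H b s) (ev H b t)" if "ev G a s \<preceq> ev G a t" for s t
  proof -
    have "ev G a (Add s (Neg (Meet s t))) = \<one>"
      using that by (simp add: lle_def)
    then have "ev H b (Add s (Neg (Meet s t))) = \<one>\<^bsub>H\<^esub>"
      using JH[of "Add s (Neg (Meet s t))"] JH[of Zero] by simp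
    then have "ev H b s = ev H b (Meet s t)"
      using cl cl[of "Meet s t"] H.inv_equality by (metis H.inv_inv H.inv_closed ev.simps(3,4))
    then show ?thesis by (simp add: H.lle_def)
  qed
  have pow: "ev K c (tmul j s) = ev K c s [^]\<^bsub>K\<^esub> j" for K :: "'a set lgroup" and c j s
    by (induction j) auto
  have one: "H.lle (b 0) \<one>\<^bsub>H\<^esub>"
    using mono[of "Var 0" "tmul k t"] le t JH by (simp add: ev_tmul pow)
  have neg: "H.lle (ev H b s) \<one>\<^bsub>H\<^esub>" for s
  proof -
    obtain j :: nat where "ev G a s \<preceq> a 0 [^] j" using order_unit[of "ev G a s"] by (auto simp: lorder_iff)
    then have "H.lle (ev H b s) (b 0 [^]\<^bsub>H\<^esub> j)"
      using mono[of s "tmul j (Var 0)"] by (simp add: ev_tmul pow)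
    moreover have "H.lle (b 0 [^]\<^bsub>H\<^esub> j) \<one>\<^bsub>H\<^esub>"
      using H.nat_pow_mono[OF one b H.one_closed, of j] by simp
    ultimately show ?thesis using cl b H.lle_trans[of "ev H b s" "b 0 [^]\<^bsub>H\<^esub> j" "\<one>\<^bsub>H\<^esub>"] by simp
  qed
  have "ev H b s = \<one>\<^bsub>H\<^esub>" for s
  proof (rule H.lle_antisym[OF neg])
    show "H.lle \<one>\<^bsub>H\<^esub> (ev H b s)"
      using neg[of "Neg s"] H.inv_lle_iff[of "ev H b s" "\<one>\<^bsub>H\<^esub>"] cl by simp
  qed (use cl in auto)
  then show ?thesis using JH JG gen by auto
qed

definition points :: "(nat \<Rightarrow> real) set" where
  "points = {x \<in> orthant n. lev x f = 0 \<and> x 0 = 1}"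

definition point_ideal :: "(nat \<Rightarrow> real) \<Rightarrow> 'a set" where
  "point_ideal x = {ev G a t |t. lev x t = 0}"

lemma points_eval: "\<lbrakk>x \<in> points; ev G a s = ev G a t\<rbrakk> \<Longrightarrow> lev x s = lev x t"
  unfolding points_def using rel_eval by blast

lemma mem_point_ideal: "x \<in> points \<Longrightarrow> ev G a t \<in> point_ideal x \<longleftrightarrow> lev x t = 0"
  unfolding point_ideal_def using points_eval[of x t] by fastforce

lemma points_le: "x \<in> points \<Longrightarrow> x i \<le> real N"
  using rel_bounded[of x i] by (simp add: points_def)

lemma point_ideal_proper: "x \<in> points \<Longrightarrow> point_ideal x \<noteq> carrier G"
proof
  assume x: "x \<in> points" and "point_ideal x = carrier G"
  then have "ev G a (Var 0) \<in> point_ideal x" by (metis ev_closed)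
  then have "x 0 = 0" using mem_point_ideal[OF x, of "Var 0"] by simp
  moreover have "x 0 = 1" using x unfolding points_def by blast
  ultimately show False by simp
qed

lemma lideal_point_ideal:
  assumes x: "x \<in> points"
  shows "lideal G (a 0) (point_ideal x)"
proof -
  let ?K = "fun_lgroup {x}"
  have K: "unital_lgroup ?K (lfun {x} (Var 0))"
    using x points_le[OF x] by (intro unital_fun_lgroup[of _ "real N"]) (auto simp: points_def orthant_def)
  have cl: "ev ?K (\<lambda>i. lfun {x} (Var i)) t \<in> carrier ?K" for t
    unfolding ev_fun_lgroup fun_lgroup_simps by blast
  have wd: "ev ?K (\<lambda>i. lfun {x} (Var i)) s = ev ?K (\<lambda>i. lfun {x} (Var i)) t"
    if "ev G a s = ev G a t" for s t
    using points_eval[OF x that] unfolding ev_fun_lgroup lfun_eq_iff by blast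
  obtain h where h: "h \<in> ulhom G (a 0) ?K (lfun {x} (Var 0))" "\<And>t. h (ev G a t) = lfun {x} t"
    using ulhom_of_ev[OF gen cl wd] unfolding ev_fun_lgroup by blast
  have "h ` carrier G = carrier ?K" by (simp add: gen image_image h(2) fun_lgroup_simps)
  moreover have "h (ev G a t) = \<one>\<^bsub>?K\<^esub> \<longleftrightarrow> lev x t = 0" for t
    by (simp add: h(2) fun_lgroup_simps lfun_eq_iff)
  then have "kernel G ?K h = point_ideal x"
    unfolding kernel_def point_ideal_def gen by blast
  ultimately show ?thesis using lideal_kernel[OF K h(1)] by simp
qed

text \<open>The values at \<open>x\<close> are Archimedean: if \<open>t(x) \<noteq> 0\<close>, then \<open>M \<bar>t\<bar>\<close> exceeds the unit near \<open>x\<close>, so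
the unit is below \<open>s + k\<close> with \<open>s = M \<bar>t\<bar>\<close> and \<open>k = (u - s)\<^sup>+\<close>, where \<open>k\<close> vanishes at \<open>x\<close>.\<close>

lemma point_ideal_maximal:
  assumes x: "x \<in> points" and J: "lideal G (a 0) J" "point_ideal x \<subseteq> J"
  shows "J = point_ideal x \<or> J = carrier G"
proof (rule disjCI)
  assume "J \<noteq> carrier G"
  obtain H :: "'a set lgroup" and b where H: "lgroup H" and b: "\<And>i. b i \<in> carrier H"
    and JH: "\<And>t. ev G a t \<in> J \<longleftrightarrow> ev H b t = \<one>\<^bsub>H\<^esub>" and JG: "J \<subseteq> carrier G"
    using lideal_ev[OF J(1)] by metis
  interpret H: lgroup H by fact
  have "g \<in> point_ideal x" if g: "g \<in> J" for g
  proof (rule ccontr)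
    assume "g \<notin> point_ideal x"
    obtain t where t: "g = ev G a t" using g JG gen by auto
    then have lt: "lev x t \<noteq> 0" using \<open>g \<notin> point_ideal x\<close> x by (simp add: mem_point_ideal)
    obtain M :: nat where M: "1 < real M * \<bar>lev x t\<bar>"
      using reals_Archimedean3[of "\<bar>lev x t\<bar>"] lt by auto
    define s where "s = tmul M (tabs t)"
    define k where "k = tpos (Add (Var 0) (Neg s))"
    have "lev x k = 0" using M x by (simp add: k_def s_def points_def)
    then have "ev G a k \<in> J" using J(2) x by (auto simp: mem_point_ideal[symmetric])
    then have kH: "ev H b k = \<one>\<^bsub>H\<^esub>" using JH by simp
    have "ev H b t = \<one>\<^bsub>H\<^esub>" using g t JH by simp
    then have "ev H b (tabs t) = \<one>\<^bsub>H\<^esub>" by (simp add: tabs_def H.lle_join_iff[symmetric])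
    then have "ev H b s = \<one>\<^bsub>H\<^esub>" unfolding s_def by (induction M) auto
    then have "ev H b (Add s k) = \<one>\<^bsub>H\<^esub>" using kH by simp
    then have "ev G a (Add s k) \<in> J" using JH[of "Add s k"] by blast
    moreover have "a 0 \<preceq> ev G a (Add s k) [^] (1::nat)"
    proof -
      have "ev G a s \<otimes> (a 0 \<otimes> inv (ev G a s)) \<preceq> ev G a s \<otimes> ev G a k"
        by (intro mult_lle_mono) (auto simp: k_def tpos_def join_lge1 join_closed)
      then show ?thesis by (simp add: m_lcomm[of "ev G a s" "a 0"])
    qed
    ultimately show False using lideal_eq_carrier[OF J(1)] \<open>J \<noteq> carrier G\<close> by blast
  qed
  then show "J = point_ideal x" using J(2) by blast
qed

lemma point_ideal_MaxSpec: "x \<in> points \<Longrightarrow> point_ideal x \<in> MaxSpec G (a 0)"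
  using lideal_point_ideal point_ideal_proper point_ideal_maximal by (auto simp: MaxSpec_def)

lemma compactin_points: "compactin (powertop_real UNIV) points"
proof (rule closed_compactin)
  show "compactin (powertop_real UNIV) (PiE UNIV (\<lambda>i. {0..real N}))"
    by (simp add: compactin_PiE)
  show "points \<subseteq> PiE UNIV (\<lambda>i. {0..real N})"
    using points_le by (auto simp: PiE_def points_def orthant_def)
  have coord: "closedin (powertop_real UNIV) {x. x i \<in> C}" if "closed C" for i and C :: "real set"
    using closedin_continuous_map_preimage[OF continuous_map_product_projection, of i UNIV "\<lambda>_. euclideanreal" C] that
    by simp
  have "closedin (powertop_real UNIV) {x. lev x f \<in> {0}}"
    using closedin_continuous_map_preimage[OF continuous_map_lev[of f], of "{0}"] by simp
  moreover have "points = {x. lev x f \<in> {0}} \<inter> {x. x 0 \<in> {1}} \<inter>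
      (\<Inter>i. {x. x i \<in> {0..}} \<inter> {x. x i \<in> (if i \<ge> n then {0} else UNIV)})"
    by (auto simp: points_def orthant_def split: if_splits)
  moreover have "closedin (powertop_real UNIV) \<dots>"
    using calculation(1) by (intro closedin_Int closedin_INT coord) auto
  ultimately show "closedin (powertop_real UNIV) points" by simp
qed

text \<open>Otherwise the sum of the absolute values of these words is positive on all points, so one of its multiples
exceeds the unit and the ideal is not proper.\<close>

lemma common_zero:
  assumes J: "lideal G (a 0) J" "J \<noteq> carrier G" and T: "finite T" "\<And>t. t \<in> T \<Longrightarrow> ev G a t \<in> J"
  shows "\<exists>x\<in>points. \<forall>t\<in>T. lev x t = 0"
proof (rule ccontr)
  assume none: "\<not> ?thesis"
  obtain H :: "'a set lgroup" and b where H: "lgroup H" and b: "\<And>i. b i \<in> carrier H"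
    and JH: "\<And>t. ev G a t \<in> J \<longleftrightarrow> ev H b t = \<one>\<^bsub>H\<^esub>" and JG: "J \<subseteq> carrier G"
    using lideal_ev[OF J(1)] by metis
  interpret H: lgroup H by fact
  obtain l where l: "set l = T" using finite_list[OF T(1)] by blast
  define s where "s = tsum (\<lambda>i. tabs (l ! i)) (length l)"
  have "ev H b (tabs (l ! i)) = \<one>\<^bsub>H\<^esub>" if "i < length l" for i
  proof -
    have "ev H b (l ! i) = \<one>\<^bsub>H\<^esub>" using T(2)[of "l ! i"] l that JH by auto
    then show ?thesis by (simp add: tabs_def H.lle_join_iff[symmetric])
  qed
  then have "ev H b (tsum (\<lambda>i. tabs (l ! i)) j) = \<one>\<^bsub>H\<^esub>" if "j \<le> length l" for j
    using that by (induction j) auto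
  then have sJ: "ev G a s \<in> J" using JH by (simp add: s_def)
  have s_nn: "lev x s \<ge> 0" for x :: "nat \<Rightarrow> real" by (auto simp: s_def intro!: sum_nonneg)
  have s_pos: "lev x s > 0" if "x \<in> points" for x
  proof -
    obtain t where t: "t \<in> T" "lev x t \<noteq> 0" using none \<open>x \<in> points\<close> by blast
    then obtain i where i: "i < length l" "l ! i = t" using l by (auto simp: in_set_conv_nth)
    have "\<bar>lev x (l ! i)\<bar> \<le> lev x s"
      unfolding s_def lev_tsum lev_tabs using i by (intro member_le_sum) auto
    then show ?thesis using t i by auto
  qed
  have "\<exists>k::nat. a 0 \<preceq> ev G a s [^] k"
  proof (rule bounded_by_multiple_of_positive[OF rel_nonneg rel_one])
    fix x :: "nat \<Rightarrow> real" assume x: "x \<in> orthant n" "lev x f = 0" "\<exists>i<n. x i > 0"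
    from x(1) rel_bounded[OF x(1,2)] show "lev x s > 0"
    proof (cases rule: orthant_cases)
      case 1
      then show ?thesis using x(3) by simp
    next
      case (2 y)
      have sc: "lev x t = x 0 * lev y t" for t
        using lev_scale[of "x 0" y t] 2(4,5) by (metis less_imp_le)
      have "y \<in> points" using 2(1-4) sc[of f] x(2) by (simp add: points_def)
      then show ?thesis using s_pos 2(4) by (simp add: sc)
    qed
  qed
  then show False using lideal_eq_carrier[OF J(1) sJ] J(2) by blast
qed

text \<open>The zero sets of the members of a maximal ideal have the finite intersection property in
a compact space, so the ideal is contained in the ideal of a common zero.\<close>

lemma MaxSpec_points:
  assumes m: "\<mm> \<in> MaxSpec G (a 0)"
  shows "\<exists>x\<in>points. \<mm> = point_ideal x"
proof -
  have J: "lideal G (a 0) \<mm>" "\<mm> \<noteq> carrier G" using m by (auto simp: MaxSpec_def)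
  define Z where "Z t = {x. lev x t = (0::real)}" for t
  define U where "U = Z ` {t. ev G a t \<in> \<mm>}"
  have "closedin (powertop_real UNIV) (Z t)" for t
    using closedin_continuous_map_preimage[OF continuous_map_lev[of t], of "{0}"] by (simp add: Z_def)
  moreover have "points \<inter> \<Inter>F \<noteq> {}" if F: "finite F" "F \<subseteq> U" for F
  proof -
    obtain T where T: "T \<subseteq> {t. ev G a t \<in> \<mm>}" "finite T" "F = Z ` T"
      using finite_subset_image[OF F[unfolded U_def]] by blast
    then obtain x where "x \<in> points" "\<forall>t\<in>T. lev x t = 0" using common_zero[OF J] by blast
    then show ?thesis using T by (auto simp: Z_def)
  qed
  ultimately have "points \<inter> \<Inter>U \<noteq> {}"
    using compactin_points unfolding compactin_fip by (auto simp: U_def)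
  then obtain x where x: "x \<in> points" "\<And>t. ev G a t \<in> \<mm> \<Longrightarrow> lev x t = 0"
    by (auto simp: U_def Z_def)
  have "\<mm> \<subseteq> carrier G" using lideal_ev[OF J(1)] by metis
  then have "\<mm> \<subseteq> point_ideal x" using x gen by (auto simp: mem_point_ideal)
  then have "point_ideal x = \<mm>"
    using m lideal_point_ideal[OF x(1)] point_ideal_proper[OF x(1)] by (auto simp: MaxSpec_def)
  then show ?thesis using x(1) by blast
qed

text \<open>If \<open>x i < p / q < y i\<close>, the negative and the positive part of \<open>q a i - p u\<close> are disjoint and are nonzero at
\<open>x\<close> and at \<open>y\<close>.\<close>

lemma separate_points:
  assumes "x \<in> points" "y \<in> points" "x \<noteq> y"
  obtains s t where "lev x s \<noteq> 0" "lev y t \<noteq> 0" "\<And>z :: nat \<Rightarrow> real. lev z s = 0 \<or> lev z t = 0"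
proof -
  have *: "\<exists>s t. lev x s \<noteq> 0 \<and> lev y t \<noteq> 0 \<and> (\<forall>z :: nat \<Rightarrow> real. lev z s = 0 \<or> lev z t = 0)"
    if x: "x \<in> points" and y: "y \<in> points" and i: "x i < y i" for x y i
  proof -
    obtain r where r: "r \<in> \<rat>" "x i < r" "r < y i" using Rats_dense_in_real[OF i] by blast
    have "x i \<ge> 0" using x by (auto simp: points_def orthant_def)
    then obtain p q :: nat where q: "q \<noteq> 0" and "r = real p / real q"
      using Rats_abs_nat_div_natE[OF r(1)] r(2) by (metis abs_of_nonneg less_eq_real_def order_trans)
    then have "real p = real q * r" by simp
    then have pq: "real q * x i < real p" "real p < real q * y i"
      using r(2,3) q by simp_all
    define d where "d = Add (tmul q (Var i)) (Neg (tmul p (Var 0)))"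
    show ?thesis
      by (rule exI[of _ "tpos (Neg d)"], rule exI[of _ "tpos d"])
        (use x y pq in \<open>auto simp: d_def points_def max_def\<close>)
  qed
  obtain i where "x i < y i \<or> y i < x i" using assms(3) by (metis ext linorder_neqE)
  then show ?thesis using *[of x y i] *[of y x i] assms that by metis
qed

lemma point_ideal_inj: "inj_on point_ideal points"
proof (rule inj_onI, rule ccontr)
  fix x y assume xy: "x \<in> points" "y \<in> points" "point_ideal x = point_ideal y" "x \<noteq> y"
  obtain s t where st: "lev x s \<noteq> 0" "lev y t \<noteq> 0" "\<And>z :: nat \<Rightarrow> real. lev z s = 0 \<or> lev z t = 0"
    using separate_points[OF xy(1,2,4)] by metis
  then have "lev y s = 0" by blast
  then show False using st(1) mem_point_ideal[OF xy(1), of s] mem_point_ideal[OF xy(2), of s] xy(3) by simp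
qed

lemma Hausdorff_spectral: "Hausdorff_space (spectral_topology G (a 0))"
  unfolding Hausdorff_space_def topspace_spectral_topology
proof (intro allI impI, elim conjE)
  fix m m' assume m: "m \<in> MaxSpec G (a 0)" "m' \<in> MaxSpec G (a 0)" "m \<noteq> m'"
  obtain x y where x: "x \<in> points" "m = point_ideal x" and y: "y \<in> points" "m' = point_ideal y"
    using MaxSpec_points m by metis
  then have "x \<noteq> y" using m by auto
  then obtain s t where st: "lev x s \<noteq> 0" "lev y t \<noteq> 0" "\<And>z :: nat \<Rightarrow> real. lev z s = 0 \<or> lev z t = 0"
    using separate_points[OF x(1) y(1)] by metis
  define U where "U s = MaxSpec G (a 0) - {\<mm> \<in> MaxSpec G (a 0). ev G a s \<in> \<mm>}" for s
  have "openin (spectral_topology G (a 0)) (U s)" for s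
    unfolding spectral_topology_def U_def by (rule topology_generated_by_Basis) auto
  moreover have "m \<in> U s" "m' \<in> U t" using m x y st by (auto simp: U_def mem_point_ideal)
  moreover have "disjnt (U s) (U t)"
    using MaxSpec_points st(3) by (force simp: disjnt_def U_def mem_point_ideal)
  ultimately show "\<exists>U V. openin (spectral_topology G (a 0)) U \<and> openin (spectral_topology G (a 0)) V \<and>
      m \<in> U \<and> m' \<in> V \<and> disjnt U V" by blast
qed

lemma continuous_map_point_ideal:
  assumes "continuous_map S (powertop_real UNIV) c" "c ` topspace S \<subseteq> points"
  shows "continuous_map S (spectral_topology G (a 0)) (\<lambda>y. point_ideal (c y))"
  unfolding spectral_topology_def
proof (rule continuous_on_generated_topo)
  let ?B = "(\<lambda>g. MaxSpec G (a 0) - {\<mm> \<in> MaxSpec G (a 0). g \<in> \<mm>}) ` carrier G"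
  show "(\<lambda>y. point_ideal (c y)) ` topspace S \<subseteq> \<Union> ?B"
    using assms(2) point_ideal_MaxSpec topspace_spectral_topology[of G "a 0"]
    unfolding spectral_topology_def topology_generated_by_topspace by blast
  fix U assume "U \<in> ?B"
  then obtain t where t: "U = MaxSpec G (a 0) - {\<mm> \<in> MaxSpec G (a 0). ev G a t \<in> \<mm>}" using gen by auto
  have "continuous_map S euclideanreal (\<lambda>y. lev (c y) t)"
    using continuous_map_compose[OF assms(1) continuous_map_lev[of t]] by (simp add: o_def)
  then have "openin S {y \<in> topspace S. lev (c y) t \<in> - {0}}"
    by (rule openin_continuous_map_preimage) auto
  moreover have "(\<lambda>y. point_ideal (c y)) -` U \<inter> topspace S = {y \<in> topspace S. lev (c y) t \<in> - {0}}"
    using assms(2) point_ideal_MaxSpec by (auto simp: t mem_point_ideal image_subset_iff)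
  ultimately show "openin S ((\<lambda>y. point_ideal (c y)) -` U \<inter> topspace S)" by simp
qed

end

section \<open>The basis\<close>

context lgroup
begin

lemma lgenerate_closed: "\<lbrakk>B \<subseteq> carrier G; x \<in> lgenerate G B\<rbrakk> \<Longrightarrow> x \<in> carrier G"
  by (rotate_tac 1, induction rule: lgenerate.induct) (auto simp: join_closed meet_closed)

lemma lgenerate_int_pow:
  assumes B: "B \<subseteq> carrier G" and "x \<in> lgenerate G B"
  shows "x [^] (k::int) \<in> lgenerate G B"
proof -
  have nat: "x [^] (j::nat) \<in> lgenerate G B" for j
    using assms(2) by (induction j) (auto intro: lgenerate.one lgenerate.mult)
  show ?thesis
    using nat lgenerate_closed[OF assms]
    by (cases k rule: int_cases2) (auto simp: int_pow_int int_pow_neg_int intro: lgenerate.inv)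
qed

lemma lgenerate_finprod:
  assumes B: "B \<subseteq> carrier G" and g: "\<And>i. i \<in> I \<Longrightarrow> g i \<in> lgenerate G B"
  shows "finprod G g I \<in> lgenerate G B"
  using g
proof (induction I rule: infinite_finite_induct)
  case (insert i I)
  then have "g \<in> I \<rightarrow> carrier G" "g i \<in> carrier G" using lgenerate_closed[OF B] by auto
  then show ?case using insert by (auto intro: lgenerate.mult)
qed (auto intro: lgenerate.one)

end

lemma ev_lgenerate: "(\<And>i. a i \<in> lgenerate G B) \<Longrightarrow> ev G a t \<in> lgenerate G B"
  by (induction t) (auto intro: lgenerate.intros)

text \<open>A fan on which the defining relation is linear. The cones spanned by the vertices in the zero set of \<open>f\<close>
triangulate this zero set, and the hats of the other vertices vanish in \<open>G\<close>.\<close>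

locale presented_fan = rational_presentation +
  fixes F :: fan
  assumes F_refines: "refines (orthant_fan n) F"
    and F_adapted: "adapted F"
    and F_lin: "lin F f"
    and F_vanish: "\<lbrakk>v < nv F; lev (pt F v) f \<noteq> 0\<rbrakk> \<Longrightarrow> hatv F v = \<one>"
begin

definition verts :: "nat set" where
  "verts = {v. v < nv F \<and> lev (pt F v) f = 0}"

abbreviation den :: "nat \<Rightarrow> int" where
  "den v \<equiv> pt F v 0"

lemma finite_verts: "finite verts"
  by (simp add: verts_def)

lemma F_wf: "wf_fan F"
  using refines_wf[OF F_refines wf_orthant_fan] .

lemma den_pos: assumes "v \<in> verts" shows "den v > 0"
proof -
  let ?x = "\<lambda>i. real_of_int (pt F v i)"
  have v: "v < nv F" "lev (pt F v) f = 0" using assms by (auto simp: verts_def)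
  obtain j where "pt F v j > 0" using pt_orthant[OF F_refines v(1)] by blast
  moreover have "?x j \<le> real N * ?x 0"
    using v by (intro rel_bounded pt_in_orthant[OF F_refines]) (simp_all add: lev_of_int)
  ultimately have "real N * real_of_int (den v) > 0" by linarith
  then show ?thesis using pt_orthant[OF F_refines v(1), of 0] by (auto simp: zero_less_mult_iff)
qed

lemma hatv_outside: "\<lbrakk>v < nv F; v \<notin> verts\<rbrakk> \<Longrightarrow> hatv F v = \<one>"
  using F_vanish by (auto simp: verts_def)

lemma points_hat:
  assumes x: "x \<in> points" and v: "v < nv F"
  shows "lev x (hat F v) \<ge> 0" and "v \<notin> verts \<Longrightarrow> lev x (hat F v) = 0"
proof -
  show "lev x (hat F v) \<ge> 0"
    using orthant_lev(1)[OF F_refines _ v] x by (simp add: points_def)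
  assume "v \<notin> verts"
  then have "ev G a (hat F v) = ev G a Zero" using hatv_outside v by simp
  then show "lev x (hat F v) = 0" using points_eval[OF x] by fastforce
qed

lemma points_conic:
  assumes x: "x \<in> points"
  shows "x i = (\<Sum>v\<in>verts. lev x (hat F v) * of_int (pt F v i))"
proof -
  have "x i = (\<Sum>v<nv F. of_int (pt F v i) * lev x (hat F v))"
    using orthant_lev(2)[OF F_refines, of x "Var i"] x by (simp add: points_def)
  also have "\<dots> = (\<Sum>v\<in>verts. of_int (pt F v i) * lev x (hat F v))"
    using points_hat(2)[OF x] by (intro sum.mono_neutral_right) (auto simp: verts_def)
  finally show ?thesis by (simp add: mult.commute)
qed

text \<open>The point with prescribed barycentric weights \<open>w\<close>, supported on a simplex of the fan.\<close>

lemma simplex_point: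
  assumes w: "\<And>v. w v \<ge> 0" "\<And>v. v \<notin> \<sigma> \<Longrightarrow> w v = 0" "(\<Sum>v\<in>\<sigma>. w v) = 1"
    and \<sigma>: "\<sigma> \<subseteq> verts" "\<sigma> \<in> cx F"
  defines "r \<equiv> \<lambda>v. w v / of_int (den v)"
  shows "conic F r \<in> points" and "v < nv F \<Longrightarrow> lev (conic F r) (hat F v) = r v"
proof -
  have \<sigma>N: "\<sigma> \<subseteq> {..<nv F}" using \<sigma>(1) by (auto simp: verts_def)
  have r: "r v \<ge> 0" "v \<notin> \<sigma> \<Longrightarrow> r v = 0" for v
    using w den_pos \<sigma>(1) by (cases "v \<in> \<sigma>"; force simp: r_def)+
  have "{v. v < nv F \<and> r v \<noteq> 0} \<subseteq> \<sigma>" using r by auto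
  then have supp: "{v. v < nv F \<and> r v \<noteq> 0} \<in> cx F" by (rule wf_fan_down[OF F_wf \<sigma>(2)])
  show hat: "lev (conic F r) (hat F v) = r v" if "v < nv F" for v
    using lev_hat_conic[OF F_refines r(1) supp that] .
  have orth: "conic F r \<in> orthant n"
    using r pt_orthant[OF F_refines] by (auto simp: orthant_def conic_def intro!: sum_nonneg)
  have "lev (conic F r) f = (\<Sum>v<nv F. of_int (lev (pt F v) f) * r v)"
    using orthant_lev(2)[OF F_refines orth F_lin] hat by simp
  also have "\<dots> = 0"
    using r(2) \<sigma>(1) by (intro sum.neutral) (auto simp: verts_def)
  finally have f0: "lev (conic F r) f = 0" .
  have "conic F r 0 = (\<Sum>v\<in>\<sigma>. r v * of_int (den v))"
    unfolding conic_def using r(2) \<sigma>N by (intro sum.mono_neutral_right) auto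
  also have "\<dots> = (\<Sum>v\<in>\<sigma>. w v)"
    using den_pos \<sigma>(1) by (intro sum.cong) (force simp: r_def)+
  finally show "conic F r \<in> points" using orth f0 w(3) by (simp add: points_def)
qed

text \<open>The vertex itself, scaled by \<open>1 / den v\<close> into the slice; there its hat has the value \<open>1 / den v\<close>. So
distinct vertices in the zero set have distinct nonzero hats.\<close>

lemma vertex_point:
  assumes v: "v \<in> verts"
  obtains x where "x \<in> points" "lev x (hat F v) \<noteq> 0" "\<And>w. w < nv F \<Longrightarrow> w \<noteq> v \<Longrightarrow> lev x (hat F w) = 0"
proof -
  have vN: "v < nv F" "{v} \<in> cx F" using v F_wf by (auto simp: verts_def wf_fan_def)
  let ?w = "\<lambda>u. if u = v then 1 else 0 :: real"
  have w: "\<And>u. ?w u \<ge> 0" "\<And>u. u \<notin> {v} \<Longrightarrow> ?w u = 0" "(\<Sum>u\<in>{v}. ?w u) = 1" "{v} \<subseteq> verts"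
    using v by auto
  note P = simplex_point[of ?w "{v}", OF w vN(2)]
  show ?thesis
    by (rule that[OF P(1)]) (use P(2) vN den_pos[OF v] in auto)
qed

lemma hatv_inj: "inj_on (hatv F) verts"
proof (rule inj_onI, rule ccontr)
  fix v w assume vw: "v \<in> verts" "w \<in> verts" "hatv F v = hatv F w" "v \<noteq> w"
  obtain x where x: "x \<in> points" "lev x (hat F v) \<noteq> 0" "\<And>w. w < nv F \<Longrightarrow> w \<noteq> v \<Longrightarrow> lev x (hat F w) = 0"
    using vertex_point[OF vw(1)] by metis
  then show False using points_eval[OF x(1) vw(3)] vw by (auto simp: verts_def)
qed

lemma hatv_nontrivial: assumes "v \<in> verts" shows "hatv F v \<noteq> \<one>"
proof
  assume *: "hatv F v = \<one>"
  obtain x where "x \<in> points" "lev x (hat F v) \<noteq> 0" using vertex_point[OF assms] by metis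
  moreover have "hatv F v = ev G a Zero" using * by simp
  ultimately show False using points_eval[of x "hat F v" Zero] by simp
qed

definition basis :: "'a set" where
  "basis = hatv F ` verts"

lemma valuation_lincomb: "a i = (\<Otimes>v\<in>verts. hatv F v [^] pt F v i)"
proof -
  have "a i = lincomb (nv F) (hatv F) (\<lambda>v. pt F v i)" using F_adapted unfolding adapted_def by blast
  also have "\<dots> = (\<Otimes>v\<in>verts. hatv F v [^] pt F v i)"
    unfolding lincomb_def
    by (rule finprod_mono_neutral_cong_right) (auto simp: verts_def Pi_iff F_vanish)
  finally show ?thesis .
qed

lemma basis_generates: "lgenerate G basis = carrier G"
proof
  have B: "basis \<subseteq> carrier G" by (auto simp: basis_def)
  then show "lgenerate G basis \<subseteq> carrier G" using lgenerate_closed by blast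
  have "a i \<in> lgenerate G basis" for i
    unfolding valuation_lincomb[of i]
    by (intro lgenerate_finprod lgenerate_int_pow B lgenerate.incl) (auto simp: basis_def)
  then show "carrier G \<subseteq> lgenerate G basis" using ev_lgenerate[of a G basis] gen by auto
qed

text \<open>The unit is the generator \<open>a 0\<close>, whose coefficient at a vertex is the denominator of the vertex.\<close>

lemma basis_unit: "\<exists>m :: 'a \<Rightarrow> int. (\<forall>b\<in>basis. m b \<ge> 1) \<and> (\<Otimes>b\<in>basis. b [^] m b) = a 0"
proof (intro exI conjI ballI)
  let ?m = "\<lambda>b. den (inv_into verts (hatv F) b)"
  have inv: "inv_into verts (hatv F) (hatv F v) = v" if "v \<in> verts" for v
    by (rule inv_into_f_f[OF hatv_inj that])
  show "?m b \<ge> 1" if "b \<in> basis" for b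
    using that den_pos inv by (auto simp: basis_def int_one_le_iff_zero_less)
  have "(\<Otimes>b\<in>basis. b [^] ?m b) = (\<Otimes>v\<in>verts. hatv F v [^] ?m (hatv F v))"
    unfolding basis_def by (rule finprod_reindex) (auto intro: hatv_inj)
  also have "\<dots> = a 0"
    unfolding valuation_lincomb[of 0] using inv by (intro finprod_cong') auto
  finally show "(\<Otimes>b\<in>basis. b [^] ?m b) = a 0" .
qed

lemma face_of_nonzero_meet:
  assumes C: "C \<subseteq> basis" "C \<noteq> {}" and nz: "\<Sqinter>\<^bsub>lorder G\<^esub> C \<noteq> \<one>"
  shows "{v \<in> verts. hatv F v \<in> C} \<in> cx F"
proof (rule ccontr)
  assume *: "{v \<in> verts. hatv F v \<in> C} \<notin> cx F"
  interpret L: lattice "lorder G" by (rule lattice_lorder)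
  have fin: "finite C" "C \<subseteq> carrier (lorder G)"
    using C finite_verts by (auto simp: basis_def lorder_def intro: finite_subset)
  define y where "y = \<Sqinter>\<^bsub>lorder G\<^esub> C"
  have gr: "greatest (lorder G) y (Lower (lorder G) C)"
    unfolding y_def using L.finite_inf_greatest[OF fin C(2)] .
  have y: "y \<in> carrier G" "\<And>c. c \<in> C \<Longrightarrow> y \<preceq> c"
    using gr fin(2) by (auto simp: greatest_def Lower_def lorder_iff) (auto simp: lorder_def)
  have pos: "\<one> \<preceq> c" if "c \<in> C" for c
    using that C(1) F_adapted by (auto simp: basis_def adapted_def verts_def)
  then have "\<one> \<in> Lower (lorder G) C"
    unfolding Lower_def lorder_iff by (auto simp: lorder_def)
  then have "\<one> \<preceq> y" using gr by (auto simp: greatest_def lorder_iff)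
  then have "y = \<one>"
    using F_adapted * y unfolding adapted_def verts_def
    by (elim conjE allE[of _ "{v \<in> {v. v < nv F \<and> lev (pt F v) f = 0}. hatv F v \<in> C}"] allE[of _ y]) auto
  then show False using nz by (simp add: y_def)
qed

text \<open>Maximal ideals are points, and those that contain the hats of all vertices outside \<open>\<sigma>\<close> are the points of the
simplex \<open>\<sigma>\<close>. In the barycentric weights the map to the spectrum is a continuous bijection from a compact space
to a Hausdorff space.\<close>

lemma face_homeomorphic_simplex:
  assumes \<sigma>: "\<sigma> \<subseteq> verts" "\<sigma> \<in> cx F" "card \<sigma> = k" "k \<ge> 1"
  shows "subtopology (spectral_topology G (a 0)) {\<mm> \<in> MaxSpec G (a 0). hatv F ` (verts - \<sigma>) \<subseteq> \<mm>}
    homeomorphic_space subtopology (powertop_real UNIV) (standard_simplex (k - 1))"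
proof -
  have fin\<sigma>: "finite \<sigma>" using \<sigma>(1) finite_verts finite_subset by blast
  obtain e where e: "bij_betw e {..<k} \<sigma>"
    using ex_bij_betw_nat_finite[OF fin\<sigma>] \<sigma>(3) by (auto simp: atLeast0LessThan)
  define e' where "e' = inv_into {..<k} e"
  have ee: "e' v < k" "e (e' v) = v" if "v \<in> \<sigma>" for v
    using that e by (auto simp: e'_def bij_betw_def f_inv_into_f)
  have e'e: "e' (e j) = j" "e j \<in> \<sigma>" if "j < k" for j
    using that e by (auto simp: e'_def bij_betw_def)
  have kk: "{..k - Suc 0} = {..<k}" using \<sigma>(4) by auto
  define w where "w y v = (if v \<in> \<sigma> then y (e' v) else 0)" for y :: "nat \<Rightarrow> real" and v
  define r where "r y v = w y v / of_int (den v)" for y v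
  define c where "c y = conic F (r y)" for y
  have sum_e: "(\<Sum>v\<in>\<sigma>. g (e' v)) = (\<Sum>j<k. g j)" for g :: "nat \<Rightarrow> real"
    using sum.reindex_bij_betw[OF e, of "\<lambda>v. g (e' v)"] e'e by simp
  have P: "c y \<in> points" "\<And>v. v < nv F \<Longrightarrow> lev (c y) (hat F v) = r y v"
    if y: "y \<in> standard_simplex (k - 1)" for y
  proof -
    have w: "w y v \<ge> 0" "v \<notin> \<sigma> \<Longrightarrow> w y v = 0" for v
      using y by (auto simp: w_def standard_simplex_def)
    have "(\<Sum>v\<in>\<sigma>. w y v) = 1"
      using sum_e[of y] y by (simp add: w_def standard_simplex_def kk)
    note P = simplex_point[of "w y" \<sigma>, OF w this \<sigma>(1,2)]
    show "c y \<in> points" "\<And>v. v < nv F \<Longrightarrow> lev (c y) (hat F v) = r y v"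
      using P by (simp_all add: c_def r_def[abs_def])
  qed
  let ?S = "subtopology (powertop_real UNIV) (standard_simplex (k - 1))"
  let ?M = "{\<mm> \<in> MaxSpec G (a 0). hatv F ` (verts - \<sigma>) \<subseteq> \<mm>}"
  let ?T = "subtopology (spectral_topology G (a 0)) ?M"
  let ?h = "\<lambda>y. point_ideal (c y)"
  have topS: "topspace ?S = standard_simplex (k - 1)" by (rule topspace_standard_simplex)
  have topT: "topspace ?T = ?M" by (auto simp: topspace_subtopology topspace_spectral_topology)
  have cont_c: "continuous_map ?S (powertop_real UNIV) c"
    unfolding continuous_map_componentwise_UNIV
  proof
    fix i
    have "continuous_map ?S euclideanreal (\<lambda>y. w y v)" for v
      unfolding w_def
      by (cases "v \<in> \<sigma>") (auto intro: continuous_map_from_subtopology continuous_map_product_projection)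
    then have "continuous_map ?S euclideanreal
        (\<lambda>y. \<Sum>v<nv F. w y v * (inverse (of_int (den v)) * of_int (pt F v i)))"
      by (intro continuous_map_sum continuous_map_real_mult_right) auto
    then show "continuous_map ?S euclideanreal (\<lambda>y. c y i)"
      by (simp add: c_def conic_def r_def divide_inverse mult.assoc)
  qed
  have into: "?h y \<in> ?M" if "y \<in> standard_simplex (k - 1)" for y
  proof -
    have "hatv F v \<in> ?h y" if "v \<in> verts - \<sigma>" for v
      using that P[OF \<open>y \<in> _\<close>] by (auto simp: mem_point_ideal r_def w_def verts_def)
    then show ?thesis using point_ideal_MaxSpec P(1)[OF that] by blast
  qed
  have cont: "continuous_map ?S ?T ?h"
    unfolding continuous_map_in_subtopology
    using continuous_map_point_ideal[OF cont_c] P(1) into topS by auto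
  have inj: "inj_on ?h (topspace ?S)"
  proof (rule inj_onI)
    fix y z assume yz: "y \<in> topspace ?S" "z \<in> topspace ?S" "?h y = ?h z"
    then have yz': "y \<in> standard_simplex (k - 1)" "z \<in> standard_simplex (k - 1)" using topS by auto
    then have cc: "c y = c z" using point_ideal_inj P(1) yz(3) by (meson inj_onD)
    show "y = z"
    proof
      fix j show "y j = z j"
      proof (cases "j < k")
        case True
        have v: "e j \<in> verts" "e j < nv F" using e'e(2)[OF True] \<sigma>(1) by (auto simp: verts_def)
        then have "r y (e j) = r z (e j)" using P(2)[OF yz'(1)] P(2)[OF yz'(2)] cc by metis
        then show ?thesis using e'e[OF True] den_pos[OF v(1)] by (simp add: r_def w_def)
      next
        case False
        then show ?thesis using yz' \<sigma>(4) by (auto simp: standard_simplex_def)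
      qed
    qed
  qed
  have surj: "?h ` topspace ?S = topspace ?T"
    unfolding topS topT
  proof (intro equalityI subsetI)
    fix \<mm> assume "\<mm> \<in> ?h ` standard_simplex (k - 1)"
    then show "\<mm> \<in> ?M" using into by blast
  next
    fix \<mm> assume m: "\<mm> \<in> ?M"
    then obtain x where x: "x \<in> points" "\<mm> = point_ideal x" using MaxSpec_points by blast
    have zero: "lev x (hat F v) = 0" if "v \<in> verts" "v \<notin> \<sigma>" for v
      using m that x by (auto simp: mem_point_ideal[OF x(1), symmetric])
    define y where "y j = (if j < k then of_int (den (e j)) * lev x (hat F (e j)) else 0)" for j
    have bary: "x i = (\<Sum>v\<in>\<sigma>. lev x (hat F v) * of_int (pt F v i))" for i
      unfolding points_conic[OF x(1), of i]
      using \<sigma>(1) finite_verts zero by (intro sum.mono_neutral_right) auto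
    have "(\<Sum>j<k. y j) = (\<Sum>v\<in>\<sigma>. y (e' v))" by (rule sum_e[symmetric])
    also have "\<dots> = (\<Sum>v\<in>\<sigma>. lev x (hat F v) * of_int (den v))"
      using ee by (intro sum.cong) (auto simp: y_def)
    also have "\<dots> = 1" using bary[of 0] x(1) by (simp add: points_def)
    finally have sum1: "(\<Sum>j<k. y j) = 1" .
    have nn: "y j \<ge> 0" for j
    proof (cases "j < k")
      case True
      then have "e j \<in> verts" "e j < nv F" using e'e(2) \<sigma>(1) by (auto simp: verts_def)
      then show ?thesis using True points_hat(1)[OF x(1)] den_pos by (simp add: y_def less_imp_le)
    qed (simp add: y_def)
    have "y j \<le> 1" for j
    proof (cases "j < k")
      case True
      then show ?thesis using member_le_sum[of j "{..<k}" y] nn sum1 by auto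
    qed (simp add: y_def)
    then have ys: "y \<in> standard_simplex (k - 1)"
      using nn sum1 \<sigma>(4) by (auto simp: standard_simplex_def kk y_def)
    have ry: "r y v = lev x (hat F v)" if "v \<in> \<sigma>" for v
      using that ee[OF that] den_pos \<sigma>(1) by (force simp: r_def w_def y_def)
    have "c y = x"
    proof
      fix i
      have "c y i = (\<Sum>v\<in>\<sigma>. r y v * of_int (pt F v i))"
        unfolding c_def conic_def using \<sigma>(1)
        by (intro sum.mono_neutral_right) (auto simp: r_def w_def verts_def)
      then show "c y i = x i" unfolding bary[of i] using ry by simp
    qed
    then show "\<mm> \<in> ?h ` standard_simplex (k - 1)" using ys x(2) by blast
  qed
  have "compact_space ?S"
    by (rule compact_space_subtopology[OF compactin_standard_simplex])
  then have "homeomorphic_map ?S ?T ?h"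
    using cont surj inj Hausdorff_space_subtopology[OF Hausdorff_spectral]
    by (intro continuous_imp_homeomorphic_map) auto
  then show ?thesis
    by (meson homeomorphic_map_imp_homeomorphic_space homeomorphic_space_sym)
qed

lemma is_basis_basis: "is_basis G (a 0) basis"
  unfolding is_basis_def
proof (intro conjI allI impI ballI)
  show "finite basis" using finite_verts by (simp add: basis_def)
  fix b assume "b \<in> basis"
  then obtain v where "v \<in> verts" "b = hatv F v" by (auto simp: basis_def)
  then show "b \<in> carrier G" "\<one> \<sqsubseteq>\<^bsub>lorder G\<^esub> b" "b \<noteq> \<one>"
    using F_adapted hatv_nontrivial by (auto simp: adapted_def verts_def lorder_iff)
next
  show "lgenerate G basis = carrier G" by (rule basis_generates)
  show "\<exists>m :: 'a \<Rightarrow> int. (\<forall>b\<in>basis. m b \<ge> 1) \<and> (\<Otimes>b\<in>basis. b [^] m b) = a 0" by (rule basis_unit)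
next
  fix k :: nat and C assume C: "k \<ge> 1" "C \<subseteq> basis" "card C = k" "\<Sqinter>\<^bsub>lorder G\<^esub> C \<noteq> \<one>"
  define \<sigma> where "\<sigma> = {v \<in> verts. hatv F v \<in> C}"
  have im: "hatv F ` \<sigma> = C" using C(2) by (auto simp: \<sigma>_def basis_def)
  have inj: "inj_on (hatv F) \<sigma>" by (rule inj_on_subset[OF hatv_inj]) (auto simp: \<sigma>_def)
  have "C \<noteq> {}" using C(1,3) by auto
  then have "\<sigma> \<in> cx F" unfolding \<sigma>_def using C face_of_nonzero_meet by blast
  moreover have "card \<sigma> = k" using card_image[OF inj] im C(3) by simp
  moreover have "basis - C = hatv F ` (verts - \<sigma>)" by (auto simp: basis_def \<sigma>_def)
  ultimately show "subtopology (spectral_topology G (a 0)) {\<mm> \<in> MaxSpec G (a 0). basis - C \<subseteq> \<mm>}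
      homeomorphic_space subtopology (powertop_real UNIV) (standard_simplex (k - 1))"
    using face_homeomorphic_simplex[of \<sigma> k] C(1) by (simp add: \<sigma>_def)
qed

end

theorem mainTheorem2:
  fixes G :: "'a lgroup" and u :: 'a
  assumes "unital_lgroup G u"
    and "finitely_generated G"
    and "infinite (UNIV :: 'b set)"
    and "projective TYPE('b) G u"
  shows "\<exists>\<B>. is_basis G u \<B>"
proof -
  obtain a n f N where P: "rational_presentation G a n f N" and a0: "a 0 = u"
    using projective_imp_presentation[OF assms] by metis
  interpret rational_presentation G a n f N by (rule P)
  obtain F where "refines (orthant_fan n) F" "adapted F" "lin F f"
    "\<forall>v<nv F. lev (pt F v) f \<noteq> 0 \<longrightarrow> hatv F v = \<one>\<^bsub>G\<^esub>"
    using adapted_fan_of_relation[OF rel_nonneg rel_one] by metis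
  then interpret presented_fan G a n f N F
    by unfold_locales auto
  show ?thesis using is_basis_basis a0 by auto
qed

end
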